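(* Let $N \ge 2$ be an integer. Then the inequality $$\left(\frac{N-1}{N}\right)^N \int_{\mathbb{R}^N_+} \frac{|u(x,y)|^N}{\left(|x|^2+(1-y)^2\right)^{\frac N2}\left(\frac{|x|^2+(1+y)^2}{4}\right)^{\frac N2}\left(\log\sqrt{\frac{|x|^2+(1+y)^2}{|x|^2+(1-y)^2}}\right)^N}\,dx\,dy \le \int_{\mathbb{R}^N_+}|\nabla u(x,y)|^N\,dx\,dy$$ holds for any $u\in \dot W_0^{1,N}(\mathbb{R}^N_+)$. Furthermore, $\left(\frac{N-1}{N}\right)^N$ is the best (largest possible) constant in this inequality, and it is not attained (i.e. equality does not hold for any nonzero $u\in\dot W_0^{1,N}(\mathbb{R}^N_+)$).
   Context: $\mathbb{R}^N_+=\{(x,y) : x\in\mathbb{R}^{N-1},\ y>0\}$ is the open half-space. For a domain $\Omega\subset\mathbb{R}^N$ and $1<p\le N$, $\dot W_0^{1,p}(\Omega)$ denotes the homogeneous Sobolev space, i.e. the completion of $C_c^\infty(\Omega)$ with respect to the (semi-)norm $\|\nabla(\cdot)\|_{L^p(\Omega)}$. *)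

theory Defs
  imports "HOL-Analysis.Analysis"
begin

fun Ck :: "nat \<Rightarrow> ('a::euclidean_space \<Rightarrow> real) \<Rightarrow> bool" where
  "Ck 0 f = continuous_on UNIV f"
| "Ck (Suc k) f = ((\<forall>z. f differentiable (at z)) \<and>
     (\<forall>b\<in>Basis. Ck k (\<lambda>z. frechet_derivative f (at z) b)))"

(* C_c^oo(Omega), each function being extended by zero to the whole space. *)
definition test_functions :: "'a::euclidean_space set \<Rightarrow> ('a \<Rightarrow> real) set" where
  "test_functions \<Omega> = {f. (\<forall>k. Ck k f) \<and>
     compact (closure {z. f z \<noteq> 0}) \<and> closure {z. f z \<noteq> 0} \<subseteq> \<Omega>}"

definition gradient :: "('a::euclidean_space \<Rightarrow> real) \<Rightarrow> 'a \<Rightarrow> 'a" where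
  "gradient f z = (\<Sum>b\<in>Basis. frechet_derivative f (at z) b *\<^sub>R b)"

(* The completion of C_c^oo(Omega) under the L^p norm of the gradient, realized as a space of
   functions: u belongs to it, with gradient g, iff some sequence of test functions has gradients
   converging to g in L^p(Omega) and itself converges to u in L^1_loc(Omega).  Passing to the limit
   in the integration by parts formula shows that g is the weak gradient of u, so it is determined
   by u up to null sets.
   The realization is the full completion as soon as every gradient-Cauchy sequence of test
   functions converges in L^1_loc(Omega).  On the half-space this holds for all p > 1 by Hardy's
   inequality  int |f|^p / y^p <= (p/(p-1))^p int |grad f|^p.  It fails, for instance, for p = N on
   the whole of R^N. *)
definition hom_sobolev0 ::
  "'a::euclidean_space set \<Rightarrow> real \<Rightarrow> ('a \<Rightarrow> real) \<Rightarrow> ('a \<Rightarrow> 'a) \<Rightarrow> bool" where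
  "hom_sobolev0 \<Omega> p u g \<longleftrightarrow>
     u \<in> borel_measurable (lebesgue_on \<Omega>) \<and> g \<in> borel_measurable (lebesgue_on \<Omega>) \<and>
     (\<exists>\<phi> :: nat \<Rightarrow> 'a \<Rightarrow> real. range \<phi> \<subseteq> test_functions \<Omega> \<and>
        (\<lambda>n. \<integral>\<^sup>+z. ennreal (norm (gradient (\<phi> n) z - g z) powr p) \<partial>lebesgue_on \<Omega>) \<longlonglongrightarrow> 0 \<and>
        (\<forall>K. compact K \<and> K \<subseteq> \<Omega> \<longrightarrow>
          (\<lambda>n. \<integral>\<^sup>+z. ennreal \<bar>\<phi> n z - u z\<bar> \<partial>lebesgue_on K) \<longlonglongrightarrow> 0))"

definition half_space :: "((real ^ 'm) \<times> real) set" where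
  "half_space = {(x, y). y > 0}"

(* The denominator vanishes on the half-space only at the point (0, 1), a null set. *)
definition hardy_integral :: "nat \<Rightarrow> ((real ^ 'm) \<times> real \<Rightarrow> real) \<Rightarrow> ennreal" where
  "hardy_integral N u = (\<integral>\<^sup>+(x, y). ennreal (\<bar>u (x, y)\<bar> ^ N /
      (((norm x)\<^sup>2 + (1 - y)\<^sup>2) powr (real N / 2) *
       (((norm x)\<^sup>2 + (1 + y)\<^sup>2) / 4) powr (real N / 2) *
       (ln (sqrt (((norm x)\<^sup>2 + (1 + y)\<^sup>2) / ((norm x)\<^sup>2 + (1 - y)\<^sup>2)))) ^ N))
     \<partial>lebesgue_on half_space)"

definition gradient_integral :: "nat \<Rightarrow> ((real ^ 'm) \<times> real \<Rightarrow> (real ^ 'm) \<times> real) \<Rightarrow> ennreal" where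
  "gradient_integral N g = (\<integral>\<^sup>+z. ennreal (norm (g z) ^ N) \<partial>lebesgue_on half_space)"

end

theory Submission
  imports Defs
begin

text \<open>
  Let \<open>p = (0, 1)\<close> and \<open>q = (0, - 1)\<close>.  The function \<open>G z = ln (\<bar>z - q\<bar> / \<bar>z - p\<bar>)\<close> is positive on the
  half-space and \<open>N\<close>-harmonic off its pole \<open>p\<close>, and \<open>\<bar>\<nabla>G\<bar> = 2 / (\<bar>z - p\<bar> \<bar>z - q\<bar>)\<close>, so that the
  weight of the inequality is \<open>(\<bar>\<nabla>G\<bar> / G)\<^sup>N\<close>.  Testing the divergence theorem with
  \<open>\<bar>u\<bar>\<^sup>N f(G) \<bar>\<nabla>G\<bar>\<^bsup>N-2\<^esup> \<nabla>G\<close> and applying Young's inequality gives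
  \<open>\<integral> \<bar>u\<bar>\<^sup>N \<bar>\<nabla>G\<bar>\<^sup>N (- f'(G) - (N - 1) f(G)\<^bsup>N/(N-1)\<^esup>) \<le> \<integral> \<bar>\<nabla>u\<bar>\<^sup>N\<close>.  With \<open>c = (N - 1) / N\<close>, the choice
  \<open>f(t) = (c / t)\<^bsup>N-1\<^esup>\<close> yields the inequality.  Perturbing it to
  \<open>f(t) = (c (1 + \<epsilon> / (1 + t)) / t)\<^bsup>N-1\<^esup>\<close> costs \<open>O(\<epsilon>\<^sup>2)\<close> and gains \<open>\<epsilon>\<close> times a positive weight; if
  equality held for some \<open>u\<close>, letting \<open>\<epsilon> \<rightarrow> 0\<close> would force \<open>u = 0\<close>.

  For the best constant take \<open>u = G\<^sup>c \<eta>(\<epsilon> ln G)\<close> with a bump function \<open>\<eta>\<close>.  Both integrals then have the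
  form \<open>\<integral> \<kappa>(\<epsilon> ln G) \<bar>\<nabla>G\<bar>\<^sup>N / G\<close>, which by the divergence theorem is proportional to \<open>\<integral> \<kappa>\<close>; the two
  functions \<open>\<kappa>\<close> are \<open>\<eta>\<^sup>N\<close> and \<open>\<bar>c \<eta> + \<epsilon> \<eta>'\<bar>\<^sup>N\<close>.
\<close>

section \<open>The divergence theorem for compactly supported fields\<close>

lemma integrable_lborel_compact_support:
  fixes f :: "'a::euclidean_space \<Rightarrow> real"
  assumes "continuous_on UNIV f" "compact K" "\<And>z. z \<notin> K \<Longrightarrow> f z = 0"
  shows "integrable lborel f"
proof -
  have "integrable lborel (\<lambda>z. indicator K z *\<^sub>R f z)"
    using assms(2) continuous_on_subset[OF assms(1)] by (intro borel_integrable_compact) auto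
  moreover have "(\<lambda>z. indicator K z *\<^sub>R f z) = f"
    using assms(3) by (fastforce simp: indicator_def)
  ultimately show ?thesis by simp
qed

lemma has_derivative_zero_outside:
  fixes f :: "'a::real_normed_vector \<Rightarrow> real"
  assumes "(f has_derivative f') (at z)" "closed K" "\<And>z. z \<notin> K \<Longrightarrow> f z = 0" "z \<notin> K"
  shows "f' = (\<lambda>_. 0)"
proof -
  have "((\<lambda>_. 0) has_derivative f') (at z)"
    using assms by (intro has_derivative_transform_within_open[OF assms(1), of "- K"]) auto
  then show ?thesis using has_derivative_unique[OF _ has_derivative_const] by blast
qed

text \<open>The integral of a difference quotient vanishes by translation invariance; pass to the limit.\<close>

lemma integral_directional_derivative_eq_0:
  fixes f :: "'a::euclidean_space \<Rightarrow> real"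
  assumes der: "\<And>z. (f has_derivative f' z) (at z)"
    and cont: "continuous_on UNIV (\<lambda>z. f' z b)"
    and K: "compact K" "\<And>z. z \<notin> K \<Longrightarrow> f z = 0"
  shows "integrable lborel (\<lambda>z. f' z b)" "(\<integral>z. f' z b \<partial>lborel) = 0"
proof -
  have f'0: "f' z b = 0" if "z \<notin> K" for z
    using has_derivative_zero_outside[OF der compact_imp_closed[OF K(1)] K(2) that] by simp
  show "integrable lborel (\<lambda>z. f' z b)"
    using integrable_lborel_compact_support[OF cont K(1) f'0] .
  have "bounded ((\<lambda>z. f' z b) ` K)"
    using compact_continuous_image[OF continuous_on_subset[OF cont] K(1)] compact_imp_bounded by auto
  then obtain B where B: "\<And>z. z \<in> K \<Longrightarrow> \<bar>f' z b\<bar> \<le> B" "B > 0"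
    unfolding bounded_pos by auto
  have B': "\<bar>f' z b\<bar> \<le> B" for z
    using B f'0 by (cases "z \<in> K") auto
  obtain r where r: "\<And>z. z \<in> K \<Longrightarrow> norm z \<le> r"
    using compact_imp_bounded[OF K(1)] unfolding bounded_iff by auto
  have cf: "continuous_on UNIV f"
    using der has_derivative_continuous continuous_at_imp_continuous_on by blast
  have If: "integrable lborel f"
    using integrable_lborel_compact_support[OF cf K] .
  have pd: "((\<lambda>t. f (z + t *\<^sub>R b)) has_real_derivative f' (z + t *\<^sub>R b) b) (at t)" for z t
  proof -
    have "((\<lambda>t. f (z + t *\<^sub>R b)) has_derivative (\<lambda>s. f' (z + t *\<^sub>R b) (s *\<^sub>R b))) (at t)"
      by (rule has_derivative_compose[OF _ der]) (auto intro!: derivative_eq_intros)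
    moreover have "linear (f' (z + t *\<^sub>R b))"
      using der has_derivative_linear by blast
    ultimately show ?thesis
      by (simp add: has_field_derivative_def linear_scale mult.commute[of _ "f' _ b"])
  qed
  \<comment> \<open>The mean value theorem bounds all difference quotients by \<open>B\<close>,
    which is the domination needed for the passage to the limit.\<close>
  have mv: "\<bar>f (z + t *\<^sub>R b) - f z\<bar> \<le> B * t" if "t > 0" for z t
  proof -
    obtain x where "f (z + t *\<^sub>R b) - f (z + 0 *\<^sub>R b) = (t - 0) * f' (z + x *\<^sub>R b) b"
      using MVT2[OF \<open>t > 0\<close>, of "\<lambda>t. f (z + t *\<^sub>R b)" "\<lambda>t. f' (z + t *\<^sub>R b) b"] pd by blast
    then show ?thesis
      using B'[of "z + x *\<^sub>R b"] that by (simp add: abs_mult mult.commute[of t] mult_right_mono)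
  qed
  define q where "q n z = real (Suc n) * (f (z + (1 / real (Suc n)) *\<^sub>R b) - f z)" for n z
  have qb: "\<bar>q n z\<bar> \<le> B" for n z
    using mult_left_mono[OF mv[of "1 / real (Suc n)" z], of "real (Suc n)"]
    by (simp add: q_def abs_mult del: of_nat_Suc)
  \<comment> \<open>Every step has length at most \<open>norm b\<close>, so one ball contains the
    supports of all difference quotients.\<close>
  have q0: "q n z = 0" if "z \<notin> cball 0 (r + norm b)" for n z
  proof -
    have "norm (z + (1 / real (Suc n)) *\<^sub>R b) > r"
    proof -
      have "norm z \<le> norm (z + (1 / real (Suc n)) *\<^sub>R b) + norm ((1 / real (Suc n)) *\<^sub>R b)"
        by (metis add_diff_cancel_right' norm_triangle_ineq4)
      moreover have "norm ((1 / real (Suc n)) *\<^sub>R b) \<le> norm b"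
        by (simp add: field_simps mult_left_mono)
      ultimately show ?thesis using that by auto
    qed
    moreover have "norm z > r" using that norm_ge_zero[of b] unfolding mem_cball_0 by linarith
    ultimately show ?thesis using r K(2) unfolding q_def
      by (metis diff_self linorder_not_le mult_zero_right)
  qed
  have qlim: "(\<lambda>n. q n z) \<longlonglongrightarrow> f' z b" for z
  proof -
    have "((\<lambda>t. (f (z + t *\<^sub>R b) - f z) / t) \<longlongrightarrow> f' z b) (at 0)"
      using pd[of z 0] by (simp add: DERIV_def)
    then have "(\<lambda>n. (f (z + (1 / real (Suc n)) *\<^sub>R b) - f z) / (1 / real (Suc n))) \<longlonglongrightarrow> f' z b"
      by (rule filterlim_compose) (use LIMSEQ_inverse_real_of_nat in \<open>simp add: filterlim_at inverse_eq_divide\<close>)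
    then show ?thesis by (simp add: q_def mult.commute del: of_nat_Suc)
  qed
  have Is: "integrable lborel (\<lambda>z. f (z + c))" "(\<integral>z. f (z + c) \<partial>lborel) = (\<integral>z. f z \<partial>lborel)" for c
  proof -
    have "f \<in> borel_measurable borel" using cf borel_measurable_continuous_onI by blast
    then show "(\<integral>z. f (z + c) \<partial>lborel) = (\<integral>z. f z \<partial>lborel)"
      using integral_distr[of "(+) c" lborel borel f] by (simp add: lborel_distr_plus add.commute)
    show "integrable lborel (\<lambda>z. f (z + c))"
      using integrable_distr_eq[of "(+) c" lborel borel f] \<open>f \<in> borel_measurable borel\<close> If
      by (simp add: lborel_distr_plus add.commute)
  qed
  have "(\<lambda>n. \<integral>z. q n z \<partial>lborel) \<longlonglongrightarrow> (\<integral>z. f' z b \<partial>lborel)"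
  proof (rule integral_dominated_convergence)
    show "integrable lborel (\<lambda>z. B * indicator (cball 0 (r + norm b)) z :: real)"
      by (intro integrable_mult_right integrable_real_indicator)
        (use emeasure_bounded_finite[OF bounded_cball] in auto)
    show "AE z in lborel. (\<lambda>n. q n z) \<longlonglongrightarrow> f' z b" using qlim by simp
    show "AE z in lborel. norm (q n z) \<le> B * indicator (cball 0 (r + norm b)) z" for n
      using qb q0 by (auto simp: indicator_def)
    show "(\<lambda>z. f' z b) \<in> borel_measurable lborel"
      using cont borel_measurable_continuous_onI by auto
    show "q n \<in> borel_measurable lborel" for n
      unfolding q_def using Is(1)[of "(1 / real (Suc n)) *\<^sub>R b"] If by (intro borel_measurable_times borel_measurable_diff) auto
  qed
  moreover have "(\<integral>z. q n z \<partial>lborel) = 0" for n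
    unfolding q_def using Is[of "(1 / real (Suc n)) *\<^sub>R b"] If by simp
  ultimately show "(\<integral>z. f' z b \<partial>lborel) = 0"
    by (simp add: LIMSEQ_const_iff)
qed

text \<open>The derivative is continued by zero outside \<open>U\<close>. The open sets
  \<open>U\<close> and \<open>- K\<close> cover the space, and both descriptions give zero on their
  overlap, so the global version applies to the extension \<open>h\<close>.\<close>

lemma integral_directional_derivative_eq_0_on:
  fixes f :: "'a::euclidean_space \<Rightarrow> real"
  assumes der: "\<And>z. z \<in> U \<Longrightarrow> (f has_derivative f' z) (at z)"
    and cont: "continuous_on U (\<lambda>z. f' z b)"
    and K: "open U" "compact K" "K \<subseteq> U" "\<And>z. z \<notin> K \<Longrightarrow> f z = 0"
  shows "integrable lborel (\<lambda>z. indicator K z * f' z b)"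
    "(\<integral>z. indicator K z * f' z b \<partial>lborel) = 0"
proof -
  define h where "h z v = indicator K z * f' z v" for z v
  have cK: "closed K" using K compact_imp_closed by blast
  have zero: "f' z = (\<lambda>_. 0)" if "z \<in> U" "z \<notin> K" for z
    using has_derivative_zero_outside[OF der[OF that(1)] cK K(4) that(2)] .
  have h0: "h z = (\<lambda>_. 0)" if "z \<notin> K" for z
    using that by (simp add: h_def fun_eq_iff)
  have hU: "h z = f' z" if "z \<in> U" for z
    using zero[OF that] by (cases "z \<in> K") (auto simp: h_def fun_eq_iff)
  have hd: "(f has_derivative h z) (at z)" for z
  proof (cases "z \<in> U")
    case True
    then show ?thesis using der hU by simp
  next
    case False
    then have "z \<in> - K" using K by auto
    then show ?thesis unfolding h0[OF \<open>z \<in> - K\<close>[THEN ComplD]]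
      using K(4) cK by (intro has_derivative_transform_within_open[OF has_derivative_const, of "- K"]) auto
  qed
  have "continuous_on (U \<union> - K) (\<lambda>z. h z b)"
  proof (rule continuous_on_open_Un)
    show "continuous_on U (\<lambda>z. h z b)" using cont hU by (simp cong: continuous_on_cong)
    show "continuous_on (- K) (\<lambda>z. h z b)" 
      by (rule continuous_on_eq[OF continuous_on_const[of _ 0]]) (simp add: h0)
  qed (use K cK in auto)
  moreover have "U \<union> - K = UNIV" using K by auto
  ultimately have "continuous_on UNIV (\<lambda>z. h z b)" by simp
  from integral_directional_derivative_eq_0[OF hd this K(2,4)]
  show "integrable lborel (\<lambda>z. indicator K z * f' z b)"
    "(\<integral>z. indicator K z * f' z b \<partial>lborel) = 0"
    by (simp_all add: h_def)
qed

section \<open>The field of two poles\<close>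

lemma has_derivative_norm_diff:
  "z \<noteq> c \<Longrightarrow> ((\<lambda>z. norm (z - c)) has_derivative (\<lambda>v. (z - c) \<bullet> v / norm (z - c))) (at z)"
  for z c :: "'a::real_inner"
  by (rule has_derivative_eq_rhs[OF has_derivative_compose[OF _ has_derivative_norm]])
    (auto intro!: derivative_eq_intros simp: sgn_div_norm fun_eq_iff divide_inverse inner_commute)

text \<open>This is the inversion in the unit sphere about \<open>c\<close>. The field
  \<open>dG\<close> is a difference of two inversions, so this formula feeds the computation of the
  divergence of \<open>Y\<close>.\<close>

lemma inversion_derivative:
  fixes z c :: "'a::real_inner"
  assumes "z \<noteq> c"
  shows "((\<lambda>z. (z - c) /\<^sub>R (norm (z - c))\<^sup>2) has_derivative
    (\<lambda>v. v /\<^sub>R (norm (z - c))\<^sup>2 - (2 * ((z - c) \<bullet> v) / (norm (z - c))^4) *\<^sub>R (z - c))) (at z)"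
  using assms
  by (auto intro!: derivative_eq_intros has_derivative_norm_diff
      simp: fun_eq_iff field_simps power2_eq_square power4_eq_xxxx)

lemma trace_inner_inner: "(\<Sum>b\<in>Basis. (x \<bullet> b) * (y \<bullet> b)) = x \<bullet> y" for x y :: "'a::euclidean_space"
  by (simp add: euclidean_inner[of x y])

text \<open>With abstract poles, \<open>Om\<close> is the open half-space of points closer to
  \<open>p\<close> than to \<open>q\<close>, and coordinates enter only in the final theorem. The
  bound on the dimension makes the truncated difference \<open>DIM('a) - 2\<close> the true exponent
  in \<open>Y\<close>.\<close>

locale two_poles =
  fixes p q :: "'a::euclidean_space"
  assumes pq: "p \<noteq> q" and dim2: "2 \<le> DIM('a)"
begin

definition Om :: "'a set" where "Om = {z. norm (z - p) < norm (z - q)}"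

definition G :: "'a \<Rightarrow> real" where "G z = ln (norm (z - q) / norm (z - p))"

definition dG :: "'a \<Rightarrow> 'a" where
  "dG z = (z - q) /\<^sub>R (norm (z - q))\<^sup>2 - (z - p) /\<^sub>R (norm (z - p))\<^sup>2"

definition gr :: "'a \<Rightarrow> real" where "gr z = norm (p - q) / (norm (z - p) * norm (z - q))"

text \<open>The field |grad G|^(N-2) grad G of the N-Laplace equation, with \<open>dG\<close> the
  gradient of \<open>G\<close> and \<open>gr\<close> the closed form of its length.\<close>

definition Y :: "'a \<Rightarrow> 'a" where "Y z = gr z ^ (DIM('a) - 2) *\<^sub>R dG z"

lemma q_notin_Om: "q \<notin> Om" by (simp add: Om_def)

lemma open_Om: "open Om"
  unfolding Om_def by (intro open_Collect_less continuous_intros)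

text \<open>The distance identity for inversions: |B/|B|^2 - A/|A|^2| = |B - A| / (|A| |B|), where
  \<open>B - A = p - q\<close>. Squaring turns both sides into rational expressions in inner
  products of \<open>A\<close> and \<open>B\<close>.\<close>

lemma norm_dG:
  assumes "z \<noteq> p" "z \<noteq> q"
  shows "norm (dG z) = gr z"
proof -
  define A B where "A = z - p" and "B = z - q"
  have AB: "A \<bullet> A > 0" "B \<bullet> B > 0" using assms by (auto simp: A_def B_def)
  have pqAB: "p - q = B - A" by (simp add: A_def B_def)
  have "(norm (dG z))\<^sup>2 = (gr z)\<^sup>2"
    unfolding dG_def gr_def A_def[symmetric] B_def[symmetric] pqAB power_divide power_mult_distrib
      power2_norm_eq_inner inner_diff_left inner_diff_right inner_scaleR_left inner_scaleR_right
    using AB by (simp add: field_simps inner_commute)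
  then show ?thesis by (simp add: gr_def)
qed

lemma dG_inner_Y:
  assumes "z \<noteq> p" "z \<noteq> q"
  shows "dG z \<bullet> Y z = gr z ^ DIM('a)"
proof -
  have "gr z ^ DIM('a) = gr z ^ (DIM('a) - 2) * (gr z)\<^sup>2"
    using power_add[of "gr z" "DIM('a) - 2" 2] dim2 le_add_diff_inverse2 by metis
  then show ?thesis using norm_dG[OF assms]
    by (simp add: Y_def flip: power2_norm_eq_inner)
qed

lemma norm_Y:
  assumes "z \<noteq> p" "z \<noteq> q"
  shows "norm (Y z) = gr z ^ (DIM('a) - 1)"
proof -
  have "DIM('a) - 1 = Suc (DIM('a) - 2)" using dim2 by simp
  then have "gr z ^ (DIM('a) - 1) = gr z ^ (DIM('a) - 2) * gr z"
    by (simp add: mult.commute)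
  moreover have "gr z \<ge> 0" by (simp add: gr_def)
  ultimately show ?thesis using norm_dG[OF assms] by (simp add: Y_def)
qed

lemma gr_pos: "z \<noteq> p \<Longrightarrow> z \<noteq> q \<Longrightarrow> gr z > 0"
  using pq by (simp add: gr_def)

lemma G_pos: "z \<in> Om \<Longrightarrow> z \<noteq> p \<Longrightarrow> G z > 0"
  by (auto simp: G_def Om_def less_divide_eq intro!: ln_gt_zero)

lemma G_derivative:
  assumes "z \<noteq> p" "z \<noteq> q"
  shows "(G has_derivative (\<lambda>v. dG z \<bullet> v)) (at z)"
proof -
  have eq: "\<forall>\<^sub>F w in at z. ln (norm (w - q)) - ln (norm (w - p)) = G w"
  proof -
    have "\<forall>\<^sub>F w in at z. w \<in> - {p, q}"
      using assms by (intro eventually_at_in_open') auto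
    then show ?thesis
      by eventually_elim (auto simp: G_def ln_div)
  qed
  have "((\<lambda>w. ln (norm (w - q)) - ln (norm (w - p))) has_derivative (\<lambda>v. dG z \<bullet> v)) (at z)"
    using assms
    by (auto intro!: derivative_eq_intros has_derivative_norm_diff
        simp: dG_def inner_diff_left fun_eq_iff power2_eq_square divide_inverse)
  then show ?thesis
    using assms eq by (auto intro: has_derivative_transform_eventually simp: G_def ln_div)
qed

lemma gr_derivative:
  assumes "z \<noteq> p" "z \<noteq> q"
  shows "(gr has_derivative (\<lambda>v. - gr z * ((z - p) \<bullet> v / (norm (z - p))\<^sup>2 + (z - q) \<bullet> v / (norm (z - q))\<^sup>2))) (at z)"
  unfolding gr_def[abs_def] using assms
  by (auto intro!: derivative_eq_intros has_derivative_norm_diff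
      simp: fun_eq_iff field_simps power2_eq_square)

text \<open>The product rule for \<open>Y\<close> with the power of \<open>gr\<close> taken out as a
  common factor: the first summand comes from that power, the other two from the inversions in
  \<open>dG\<close>.\<close>

definition DY :: "'a \<Rightarrow> 'a \<Rightarrow> 'a" where
  "DY z v = gr z ^ (DIM('a) - 2) *\<^sub>R
     ((- real (DIM('a) - 2) * ((z - p) \<bullet> v / (norm (z - p))\<^sup>2 + (z - q) \<bullet> v / (norm (z - q))\<^sup>2)) *\<^sub>R dG z +
      (v /\<^sub>R (norm (z - q))\<^sup>2 - (2 * ((z - q) \<bullet> v) / (norm (z - q))^4) *\<^sub>R (z - q)) -
      (v /\<^sub>R (norm (z - p))\<^sup>2 - (2 * ((z - p) \<bullet> v) / (norm (z - p))^4) *\<^sub>R (z - p)))"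

lemma Y_derivative:
  assumes "z \<noteq> p" "z \<noteq> q"
  shows "(Y has_derivative DY z) (at z)"
proof -
  define m where "m = DIM('a) - 2"
  have "(dG has_derivative (\<lambda>v. (v /\<^sub>R (norm (z - q))\<^sup>2 - (2 * ((z - q) \<bullet> v) / (norm (z - q))^4) *\<^sub>R (z - q)) -
      (v /\<^sub>R (norm (z - p))\<^sup>2 - (2 * ((z - p) \<bullet> v) / (norm (z - p))^4) *\<^sub>R (z - p)))) (at z)"
    unfolding dG_def[abs_def] using assms by (intro has_derivative_diff inversion_derivative)
  note 1 = has_derivative_scaleR[OF has_derivative_power[OF gr_derivative[OF assms], of m] this]
  show ?thesis unfolding Y_def[abs_def] m_def[symmetric]
    by (rule has_derivative_eq_rhs[OF 1], unfold DY_def m_def[symmetric])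
      (cases m; auto simp: fun_eq_iff algebra_simps)
qed

text \<open>This is the \<open>N\<close>-harmonicity of \<open>G\<close>.\<close>

lemma trace_DY:
  assumes "z \<noteq> p" "z \<noteq> q"
  shows "(\<Sum>b\<in>Basis. DY z b \<bullet> b) = 0"
proof -
  define A B where "A = z - p" and "B = z - q"
  define m where "m = DIM('a) - 2"
  have m: "real DIM('a) = real m + 2" using dim2 by (simp add: m_def of_nat_diff)
  have AB: "norm A > 0" "norm B > 0" using assms by (auto simp: A_def B_def)
  let ?a = "(norm A)\<^sup>2" and ?b = "(norm B)\<^sup>2"
  have n4: "norm A ^ 4 = ?a * ?a" "norm B ^ 4 = ?b * ?b"
    by (simp_all flip: power_add)
  have "DY z b \<bullet> b = gr z ^ m * (- real m * ((A \<bullet> b) * (dG z \<bullet> b) / ?a + (B \<bullet> b) * (dG z \<bullet> b) / ?b)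
     + ((b \<bullet> b) / ?b - 2 * ((B \<bullet> b) * (B \<bullet> b)) / (?b * ?b)) - ((b \<bullet> b) / ?a - 2 * ((A \<bullet> b) * (A \<bullet> b)) / (?a * ?a)))" for b
    unfolding DY_def A_def[symmetric] B_def[symmetric] m_def[symmetric] n4
    by (simp add: inner_diff_left inner_add_left divide_inverse algebra_simps)
  then have "(\<Sum>b\<in>Basis. DY z b \<bullet> b) = gr z ^ m * (- real m * ((A \<bullet> dG z) / ?a + (B \<bullet> dG z) / ?b)
     + (real DIM('a) / ?b - 2 * (B \<bullet> B) / (?b * ?b)) - (real DIM('a) / ?a - 2 * (A \<bullet> A) / (?a * ?a)))"
    by (simp add: sum.distrib sum_subtractf trace_inner_inner flip: sum_distrib_left sum_divide_distrib)
  \<comment> \<open>Inserting \<open>dG\<close> gives (A . dG)/|A|^2 + (B . dG)/|B|^2 = 1/|B|^2 -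
    1/|A|^2. Its coefficient -m cancels the remaining (N - 2)(1/|B|^2 - 1/|A|^2).\<close>
  also have "\<dots> = 0"
    unfolding m dG_def A_def[symmetric] B_def[symmetric] inner_diff_right inner_scaleR_right
      power2_norm_eq_inner
    using AB by (simp add: field_simps inner_commute)
  finally show ?thesis .
qed

text \<open>Since \<open>Y\<close> is divergence-free off the poles, the divergence of
  \<open>\<zeta> Y\<close> is \<zeta>' applied to \<open>Y\<close>, and it integrates to zero. The
  indicator discards the points where nothing is known about \<zeta>'.\<close>

lemma flux:
  fixes \<zeta> :: "'a \<Rightarrow> real"
  assumes der: "\<And>z. z \<in> Om - {p} \<Longrightarrow> (\<zeta> has_derivative \<zeta>' z) (at z)"
    and cont: "\<And>b. b \<in> Basis \<Longrightarrow> continuous_on (Om - {p}) (\<lambda>z. \<zeta>' z b)"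
    and K: "compact K" "K \<subseteq> Om - {p}" "\<And>z. z \<notin> K \<Longrightarrow> \<zeta> z = 0"
  shows "integrable lborel (\<lambda>z. indicator K z * \<zeta>' z (Y z))"
    "(\<integral>z. indicator K z * \<zeta>' z (Y z) \<partial>lborel) = 0"
proof -
  let ?U = "Om - {p}"
  have U: "z \<noteq> p" "z \<noteq> q" if "z \<in> ?U" for z using that q_notin_Om by auto
  define F' where "F' b z v = \<zeta> z * (DY z v \<bullet> b) + \<zeta>' z v * (Y z \<bullet> b)" for b z v
  have d: "((\<lambda>z. \<zeta> z * (Y z \<bullet> b)) has_derivative F' b z) (at z)" if "z \<in> ?U" for b z
    unfolding F'_def
    by (rule has_derivative_mult[OF der[OF that]])
      (intro has_derivative_inner_left Y_derivative U[OF that])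
  have cz: "continuous_on ?U \<zeta>"
    using der has_derivative_continuous by (blast intro: continuous_at_imp_continuous_on)
  have cY: "continuous_on ?U Y"
    using Y_derivative U has_derivative_continuous by (blast intro: continuous_at_imp_continuous_on)
  have cgr: "continuous_on ?U gr" "continuous_on ?U dG"
    unfolding gr_def[abs_def] dG_def[abs_def] using U by (auto intro!: continuous_intros)
  have cDY: "continuous_on ?U (\<lambda>z. DY z b)" for b
    unfolding DY_def using U by (auto intro!: continuous_intros cgr)
  have c: "continuous_on ?U (\<lambda>z. F' b z b)" if "b \<in> Basis" for b
    unfolding F'_def using cont[OF that] by (intro continuous_intros cz cY cDY)
  have o: "open ?U" using open_Om by auto
  have *: "integrable lborel (\<lambda>z. indicator K z * F' b z b)"
      "(\<integral>z. indicator K z * F' b z b \<partial>lborel) = 0" if "b \<in> Basis" for b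
    using integral_directional_derivative_eq_0_on[OF d c[OF that] o K(1,2)] K(3) by auto
  \<comment> \<open>Summed over the basis, the \<open>DY\<close> terms give \<zeta> times the trace
    of \<open>DY\<close>, which is 0; linearity of \<zeta>' assembles the rest.\<close>
  have eq: "indicator K z * \<zeta>' z (Y z) = (\<Sum>b\<in>Basis. indicator K z * F' b z b)" for z
  proof (cases "z \<in> K")
    case True
    then have z: "z \<in> ?U" using K by auto
    have lin: "linear (\<zeta>' z)" using der[OF z] has_derivative_linear by blast
    have "\<zeta>' z (Y z) = \<zeta>' z (\<Sum>b\<in>Basis. (Y z \<bullet> b) *\<^sub>R b)"
      by (simp add: euclidean_representation)
    also have "\<dots> = (\<Sum>b\<in>Basis. \<zeta>' z b * (Y z \<bullet> b))"
      using lin by (simp add: linear_sum linear_scale mult.commute)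
    finally show ?thesis using True trace_DY[OF U[OF z]]
      by (simp add: F'_def sum.distrib flip: sum_distrib_left)
  qed simp
  show "integrable lborel (\<lambda>z. indicator K z * \<zeta>' z (Y z))" unfolding eq
    using *(1) by (intro Bochner_Integration.integrable_sum)
  show "(\<integral>z. indicator K z * \<zeta>' z (Y z) \<partial>lborel) = 0" unfolding eq
    using * by (subst Bochner_Integration.integral_sum) auto
qed

end

section \<open>One-dimensional preliminaries\<close>

text \<open>Test functions may change sign, so |phi|^N has to be differentiated across zeros. At 0
  the difference quotient is |h|^(n-2) h, which tends to 0.\<close>

lemma abs_power_derivative:
  fixes x :: real
  assumes "2 \<le> n"
  shows "((\<lambda>x. \<bar>x\<bar> ^ n) has_real_derivative real n * (\<bar>x\<bar> ^ (n - 2) * x)) (at x)"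
proof -
  obtain m where n: "n = Suc (Suc m)"
    using assms by (metis add_2_eq_Suc le_Suc_ex)
  consider "x > 0" | "x < 0" | "x = 0" by linarith
  then show ?thesis
  proof cases
    case 1
    have "((\<lambda>x. x ^ n) has_real_derivative real n * (\<bar>x\<bar> ^ (n - 2) * x)) (at x)"
      using 1 DERIV_pow[of n x] by (simp add: n mult.commute)
    then show ?thesis
      by (rule has_field_derivative_transform_within_open[of _ _ _ "{0<..}"]) (use 1 in auto)
  next
    case 2
    have "((\<lambda>x. (- x) ^ n) has_real_derivative real n * (\<bar>x\<bar> ^ (n - 2) * x)) (at x)"
      using 2 DERIV_chain2[OF DERIV_pow[of n "- x"] DERIV_minus[OF DERIV_ident]]
      by (simp add: n mult.commute)
    then show ?thesis
      by (rule has_field_derivative_transform_within_open[of _ _ _ "{..<0}"]) (use 2 in auto)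
  next
    case 3
    have eq: "\<bar>h\<bar> * (\<bar>h\<bar> * \<bar>h\<bar> ^ m) / h = \<bar>h\<bar> ^ m * h" for h :: real
      by (cases "h = 0") (simp_all add: abs_if)
    have "((\<lambda>h::real. \<bar>h\<bar> ^ m * h) \<longlongrightarrow> 0) (at 0)"
      by (auto intro!: tendsto_eq_intros)
    then show ?thesis using 3 by (simp add: DERIV_def n eq)
  qed
qed

text \<open>Squaring the positive part removes its kink; this is what makes \<open>cut\<close>
  continuously differentiable at the threshold.\<close>

lemma max_0_power2_derivative:
  "((\<lambda>x. (max 0 x)\<^sup>2) has_real_derivative 2 * max 0 x) (at x)" for x :: real
proof -
  have *: "(max 0 x)\<^sup>2 = (x * \<bar>x\<bar> + x\<^sup>2) / 2" for x :: real
    by (simp add: max_def power2_eq_square)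
  have "((\<lambda>x. x * \<bar>x\<bar>) has_real_derivative 2 * \<bar>x\<bar>) (at x)" for x :: real
  proof -
    consider "x > 0" | "x < 0" | "x = 0" by linarith
    then show ?thesis
    proof cases
      case 1
      have "((\<lambda>x. x * x) has_real_derivative 2 * \<bar>x\<bar>) (at x)"
        using 1 by (auto intro!: derivative_eq_intros)
      then show ?thesis
        by (rule has_field_derivative_transform_within_open[of _ _ _ "{0<..}"]) (use 1 in auto)
    next
      case 2
      have "((\<lambda>x. - (x * x)) has_real_derivative 2 * \<bar>x\<bar>) (at x)"
        using 2 by (auto intro!: derivative_eq_intros)
      then show ?thesis
        by (rule has_field_derivative_transform_within_open[of _ _ _ "{..<0}"]) (use 2 in auto)
    next
      case 3
      have "((\<lambda>h::real. \<bar>h\<bar>) \<longlongrightarrow> 0) (at 0)"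
        by (auto intro!: tendsto_eq_intros)
      moreover have "h * \<bar>h\<bar> / h = \<bar>h\<bar>" for h :: real by simp
      ultimately show ?thesis using 3 by (simp only: DERIV_def) simp
    qed
  qed
  then have "((\<lambda>x. (x * \<bar>x\<bar> + x ^ 2) / 2) has_real_derivative (2 * \<bar>x\<bar> + 2 * x) / 2) (at x)"
    using DERIV_pow[of 2 x] by (intro DERIV_cdivide DERIV_add) simp_all
  moreover have "(2 * \<bar>x\<bar> + 2 * x) / 2 = 2 * max 0 x" by (simp add: max_def)
  ultimately have "((\<lambda>x. (x * \<bar>x\<bar> + x ^ 2) / 2) has_real_derivative 2 * max 0 x) (at x)"
    by simp
  then show ?thesis by (simp only: *)
qed

text \<open>A continuously differentiable substitute for the identity on the positive reals that vanishes below \<open>d\<close>.\<close>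

definition cut :: "real \<Rightarrow> real \<Rightarrow> real" where
  "cut d x = (max 0 (x - d))\<^sup>2 / x"

definition cut' :: "real \<Rightarrow> real \<Rightarrow> real" where
  "cut' d x = 2 * max 0 (x - d) / x - (max 0 (x - d))\<^sup>2 / x\<^sup>2"

lemma cut_derivative:
  assumes "x > 0"
  shows "(cut d has_real_derivative cut' d x) (at x)"
proof -
  have "((\<lambda>x. (max 0 (x - d))\<^sup>2) has_real_derivative 2 * max 0 (x - d) * (1 - 0)) (at x)"
    by (rule DERIV_chain2[OF max_0_power2_derivative DERIV_diff[OF DERIV_ident DERIV_const]])
  from DERIV_divide[OF this DERIV_ident] assms show ?thesis
    unfolding cut_def[abs_def] cut'_def by (simp add: field_simps power2_eq_square)
qed

lemma cut_eq_0: "x \<le> d \<Longrightarrow> cut d x = 0" "x \<le> d \<Longrightarrow> cut' d x = 0"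
  by (simp_all add: cut_def cut'_def max_def)

text \<open>The parameter \<open>y = max 0 (x - d) / x\<close> reduces the comparison of
  \<open>cut\<close> with its derivative to y^2 <= y (2 - y) on [0, 1]. This lets Young's inequality
  survive the truncation.\<close>

lemma cut_bounds:
  assumes "0 < d" "0 < x"
  obtains y where "0 \<le> y" "y \<le> 1" "cut d x = y\<^sup>2 * x" "cut' d x = y * (2 - y)"
proof (rule that[of "max 0 (x - d) / x"])
  show "max 0 (x - d) / x \<le> 1" using assms by (simp add: max_def)
qed (use assms in \<open>simp_all add: cut_def cut'_def field_simps power2_eq_square\<close>)

text \<open>Used to remove the truncation from the inequality for test functions.\<close>

lemma cut'_tendsto:
  assumes "0 < x"
  shows "(\<lambda>n. cut' (1 / real (Suc n)) x) \<longlonglongrightarrow> 1"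
proof -
  have "(\<lambda>n. 1 / real (Suc n)) \<longlonglongrightarrow> 0"
    using LIMSEQ_inverse_real_of_nat by (simp add: inverse_eq_divide)
  then have "(\<lambda>n. cut' (1 / real (Suc n)) x) \<longlonglongrightarrow> 2 * max 0 (x - 0) / x - (max 0 (x - 0))\<^sup>2 / x\<^sup>2"
    unfolding cut'_def by (intro tendsto_intros) (use assms in auto)
  then show ?thesis using assms by (simp add: max_def)
qed

text \<open>Young's inequality with natural exponents. The induction step multiplies the hypothesis
  by \<open>b\<close> and adds (x - b)(x^(n+1) - b^(n+1)) >= 0.\<close>

lemma Young_power:
  fixes x b :: real
  assumes "0 \<le> x" "0 \<le> b"
  shows "real (Suc n) * (x * b ^ n) \<le> x ^ Suc n + real n * b ^ Suc n"
proof (induction n)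
  case (Suc n)
  have "0 \<le> (x - b) * (x ^ Suc n - b ^ Suc n)"
  proof (cases "x \<le> b")
    case True
    then show ?thesis using assms power_mono[of x b "Suc n"] by (intro mult_nonpos_nonpos) auto
  next
    case False
    then show ?thesis using assms power_mono[of b x "Suc n"] by (intro mult_nonneg_nonneg) auto
  qed
  moreover have "b * (real (Suc n) * (x * b ^ n)) \<le> b * (x ^ Suc n + real n * b ^ Suc n)"
    using Suc assms by (intro mult_left_mono)
  ultimately show ?case by (simp add: algebra_simps)
qed simp

text \<open>To be read with \<open>X\<close> = |grad phi|, \<open>a\<close> = |phi|,
  \<open>g\<close> = |grad G|, \<open>T\<close> the inner product of grad phi with \<open>Y\<close>,
  and \<open>F\<close> the (N-1)-th root of the profile. The left side is the part of the divergence
  that contains grad phi; \<open>y\<close> comes from \<open>cut_bounds\<close>.\<close>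

lemma young_pointwise:
  fixes y a X F g T f :: real
  assumes n: "2 \<le> n" and y: "0 \<le> y" "y \<le> 1" and nn: "0 \<le> a" "0 \<le> X" "0 \<le> F" "0 \<le> g"
    and T: "\<bar>T\<bar> \<le> X * g ^ (n - 1)"
    and f: "\<bar>f\<bar> = a"
  shows "real n * (a ^ (n - 2) * f) * T * (y\<^sup>2 * F ^ (n - 1))
    \<le> X ^ n + (real n - 1) * (a * g * F) ^ n * (y * (2 - y))"
proof -
  obtain m where m: "n = Suc (Suc m)" using n by (metis add_2_eq_Suc le_Suc_ex)
  have "real n * (a ^ (n - 2) * f) * T * (y\<^sup>2 * F ^ (n - 1))
    \<le> \<bar>real n * (a ^ (n - 2) * f) * T * (y\<^sup>2 * F ^ (n - 1))\<bar>" by (rule abs_ge_self)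
  also have "\<dots> = real n * a ^ (n - 1) * \<bar>T\<bar> * (y\<^sup>2 * F ^ (n - 1))"
    using nn f by (simp add: abs_mult m)
  also have "\<dots> \<le> real n * a ^ (n - 1) * (X * g ^ (n - 1)) * (y\<^sup>2 * F ^ (n - 1))"
    using nn T by (intro mult_right_mono mult_left_mono) auto
  also have "\<dots> = y\<^sup>2 * (real (Suc (n - 1)) * (X * (a * g * F) ^ (n - 1)))"
    using n by (simp add: power_mult_distrib)
  also have "\<dots> \<le> y\<^sup>2 * (X ^ Suc (n - 1) + real (n - 1) * (a * g * F) ^ Suc (n - 1))"
    using nn by (intro mult_left_mono Young_power) auto
  also have "\<dots> = y\<^sup>2 * X ^ n + y\<^sup>2 * ((real n - 1) * (a * g * F) ^ n)"
    using n by (simp add: distrib_left of_nat_diff)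
  also have "\<dots> \<le> 1 * X ^ n + (y * (2 - y)) * ((real n - 1) * (a * g * F) ^ n)"
  proof (intro add_mono mult_right_mono)
    show "y\<^sup>2 \<le> 1" using y by (simp add: power_le_one)
    show "y\<^sup>2 \<le> y * (2 - y)" unfolding power2_eq_square using y by (intro mult_left_mono) auto
  qed (use nn n in auto)
  finally show ?thesis by (simp add: mult_ac)
qed

text \<open>The polynomial has a double zero at s = 1. Passing from n to n + 1 adds (n + 1) s^n (s -
  1)^2, and s^n is bounded on [1, 2].\<close>

lemma power_second_order:
  "\<exists>C\<ge>0. \<forall>s::real. 1 \<le> s \<longrightarrow> s \<le> 2 \<longrightarrow>
     real n * s ^ Suc n - real (Suc n) * s ^ n + 1 \<le> C * (s - 1)\<^sup>2"
proof (induction n)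
  case 0
  show ?case by (intro exI[of _ 0]) auto
next
  case (Suc n)
  then obtain C where C: "C \<ge> 0"
    "\<And>s::real. 1 \<le> s \<Longrightarrow> s \<le> 2 \<Longrightarrow> real n * s ^ Suc n - real (Suc n) * s ^ n + 1 \<le> C * (s - 1)\<^sup>2"
    by blast
  show ?case
  proof (intro exI[of _ "C + real (Suc n) * 2 ^ n"] conjI allI impI)
    fix s :: real assume s: "1 \<le> s" "s \<le> 2"
    have "real (Suc n) * s ^ Suc (Suc n) - real (Suc (Suc n)) * s ^ Suc n + 1 =
      (real n * s ^ Suc n - real (Suc n) * s ^ n + 1) + real (Suc n) * s ^ n * (s - 1)\<^sup>2"
      by (simp add: algebra_simps power2_eq_square)
    moreover have "real (Suc n) * s ^ n * (s - 1)\<^sup>2 \<le> real (Suc n) * 2 ^ n * (s - 1)\<^sup>2"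
      using s by (intro mult_right_mono mult_left_mono power_mono) auto
    ultimately show "real (Suc n) * s ^ Suc (Suc n) - real (Suc (Suc n)) * s ^ Suc n + 1
        \<le> (C + real (Suc n) * 2 ^ n) * (s - 1)\<^sup>2"
      using C(2)[OF s] unfolding distrib_right[of C] by linarith
  qed (use C in auto)
qed

section \<open>The perturbed Hardy profile\<close>

definition hardy_c :: "nat \<Rightarrow> real" where "hardy_c n = (real n - 1) / real n"

lemma hardy_c: "2 \<le> n \<Longrightarrow> 0 < hardy_c n" "2 \<le> n \<Longrightarrow> hardy_c n < 1"
  by (simp_all add: hardy_c_def)

definition pert :: "real \<Rightarrow> real \<Rightarrow> real" where "pert e t = 1 + e / (1 + t)"

definition profile :: "nat \<Rightarrow> real \<Rightarrow> real \<Rightarrow> real" where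
  "profile n e t = (hardy_c n * pert e t / t) ^ (n - 1)"

text \<open>This is -t times the derivative of 1 / (1 + t), the first-order contribution of the
  decreasing factor \<open>pert\<close>. It is positive for t > 0.\<close>

definition gain :: "real \<Rightarrow> real" where "gain t = t / (1 + t)\<^sup>2"

definition profile' :: "nat \<Rightarrow> real \<Rightarrow> real \<Rightarrow> real" where
  "profile' n e t = - (real (n - 1) * (hardy_c n * pert e t / t) ^ (n - 2) *
     (hardy_c n * (pert e t + e * gain t) / t\<^sup>2))"

lemma profile_derivative:
  assumes "2 \<le> n" "0 < t"
  shows "(profile n e has_real_derivative profile' n e t) (at t)"
proof -
  obtain m where n: "n = Suc (Suc m)"
    using assms(1) by (metis add_2_eq_Suc le_Suc_ex)
  have "((\<lambda>t. hardy_c n * pert e t / t) has_real_derivative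
     - (hardy_c n * (pert e t + e * gain t) / t\<^sup>2)) (at t)"
  proof -
    have "(pert e has_real_derivative - e / (1 + t)\<^sup>2) (at t)"
      unfolding pert_def[abs_def] using assms(2)
      by (auto intro!: derivative_eq_intros simp: power2_eq_square)
    note d = DERIV_divide[OF DERIV_cmult[OF this, of "hardy_c n"] DERIV_ident]
    have "hardy_c n * (- e / (1 + t)\<^sup>2) * t - hardy_c n * pert e t * 1
      = - (hardy_c n * (pert e t + e * gain t))"
      unfolding gain_def by (simp add: distrib_left)
    then show ?thesis using d assms(2) by (simp add: power2_eq_square)
  qed
  from DERIV_power[OF this, of "n - 1"] show ?thesis
    unfolding profile_def[abs_def] by (rule DERIV_cong) (simp add: profile'_def n)
qed

text \<open>The perturbation \<open>s = pert e t\<close> enters only to second order, because \<open>s = 1\<close> maximizes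
  \<open>s\<^bsup>n-1\<^esup> - c s\<^sup>n\<close>; what remains to first order comes from the derivative of \<open>pert\<close>.\<close>

lemma profile_gain:
  assumes "2 \<le> n"
  obtains C where "C \<ge> 0" "\<And>e t. 0 \<le> e \<Longrightarrow> e \<le> 1 \<Longrightarrow> 0 < t \<Longrightarrow>
    (hardy_c n ^ n - C * e\<^sup>2 + (real n - 1) * hardy_c n ^ (n - 1) * e * gain t) / t ^ n
    \<le> - profile' n e t - (real n - 1) * (hardy_c n * pert e t / t) ^ n"
proof -
  obtain m where n: "n = Suc (Suc m)"
    using assms(1) by (metis add_2_eq_Suc le_Suc_ex)
  obtain C where C: "C \<ge> 0"
    "\<And>s::real. 1 \<le> s \<Longrightarrow> s \<le> 2 \<Longrightarrow> real (Suc m) * s ^ n - real n * s ^ Suc m + 1 \<le> C * (s - 1)\<^sup>2"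
    using power_second_order[of "Suc m"] unfolding n by blast
  define c where "c = hardy_c n"
  have c: "0 < c" "real n * c = real (Suc m)" "real n - 1 = real (Suc m)"
    using hardy_c[OF assms] by (auto simp: c_def hardy_c_def n)
  show thesis
  proof (rule that[of "c ^ n * C"])
    fix e t :: real assume e: "0 \<le> e" "e \<le> 1" and t: "0 < t"
    define s k where "s = pert e t" and "k = gain t"
    have "e / (1 + t) \<le> e / 1" using e t by (intro divide_left_mono) auto
    then have s: "1 \<le> s" "s \<le> 2" and s1: "(s - 1)\<^sup>2 \<le> e\<^sup>2"
      using e t by (auto simp: s_def pert_def intro!: power_mono)
    have k: "0 \<le> k" using t by (simp add: k_def gain_def)
    \<comment> \<open>With n c = n - 1, the second-order estimate turns into a lower bound for
      s^(n-1) - c s^n whose loss is only of order e^2.\<close>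
    have "1 - C * e\<^sup>2 \<le> 1 - C * (s - 1)\<^sup>2"
      using C(1) s1 by (simp add: mult_left_mono)
    also have "\<dots> \<le> real n * s ^ Suc m - real (Suc m) * s ^ n"
      using C(2)[OF s] by simp
    also have "\<dots> = real n * (s ^ Suc m - c * s ^ n)"
      unfolding right_diff_distrib mult.assoc[symmetric] c(2) ..
    finally have "c * (1 - C * e\<^sup>2) \<le> c * (real n * (s ^ Suc m - c * s ^ n))"
      using c(1) by (intro mult_left_mono) auto
    also have "\<dots> = real n * c * (s ^ Suc m - c * s ^ n)" by simp
    finally have 1: "c * (1 - C * e\<^sup>2) \<le> real (Suc m) * (s ^ Suc m - c * s ^ n)"
      unfolding c(2) .
    \<comment> \<open>The factor s^(n-2) >= 1 is dropped from the gain term, leaving a bound linear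
      in e.\<close>
    have "1 * (e * k) \<le> s ^ m * (e * k)"
      using s e k by (intro mult_right_mono one_le_power) auto
    then have 2: "real (Suc m) * (e * k) \<le> real (Suc m) * (s ^ m * (e * k))"
      by (intro mult_left_mono) auto
    have "c ^ Suc m * (c * (1 - C * e\<^sup>2) + real (Suc m) * (e * k))
      \<le> c ^ Suc m * (real (Suc m) * (s ^ Suc m - c * s ^ n) + real (Suc m) * (s ^ m * (e * k)))"
      using 1 2 c(1) by (intro mult_left_mono add_mono) auto
    then have "(c ^ n - c ^ n * C * e\<^sup>2 + (real n - 1) * c ^ (n - 1) * e * k) / t ^ n
      \<le> c ^ Suc m * (real (Suc m) * (s ^ Suc m - c * s ^ n) + real (Suc m) * (s ^ m * (e * k))) / t ^ n"
      using t by (intro divide_right_mono) (auto simp: n algebra_simps)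
    \<comment> \<open>The common factor is c^(n-1) (n - 1) / t^n; what remains is s^(n-1) - c s^n +
      s^(n-2) e k.\<close>
    also have "\<dots> = - profile' n e t - (real n - 1) * (c * s / t) ^ n"
      unfolding profile'_def s_def[symmetric] k_def[symmetric] c_def[symmetric] c(3) using t
      by (simp add: n field_simps power2_eq_square)
    finally show "(hardy_c n ^ n - c ^ n * C * e\<^sup>2 + (real n - 1) * hardy_c n ^ (n - 1) * e * gain t) / t ^ n
      \<le> - profile' n e t - (real n - 1) * (hardy_c n * pert e t / t) ^ n"
      by (simp add: c_def s_def k_def)
  qed (use C c in auto)
qed

section \<open>Hardy's inequality with remainder for test functions\<close>

lemma test_function_derivative:
  assumes "\<phi> \<in> test_functions \<Omega>"
  shows "(\<phi> has_derivative (\<lambda>v. gradient \<phi> z \<bullet> v)) (at z)"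
proof -
  have "Ck (Suc 0) \<phi>" using assms by (auto simp: test_functions_def)
  then have d: "(\<phi> has_derivative frechet_derivative \<phi> (at z)) (at z)"
    by (simp add: frechet_derivative_works)
  then have lin: "linear (frechet_derivative \<phi> (at z))" using has_derivative_linear by blast
  have "frechet_derivative \<phi> (at z) v = gradient \<phi> z \<bullet> v" for v
  proof -
    have "frechet_derivative \<phi> (at z) v = frechet_derivative \<phi> (at z) (\<Sum>b\<in>Basis. (v \<bullet> b) *\<^sub>R b)"
      by (simp add: euclidean_representation)
    also have "\<dots> = gradient \<phi> z \<bullet> v"
      using lin by (simp add: linear_sum linear_scale gradient_def inner_sum_left inner_commute[of v] mult.commute)
    finally show ?thesis .
  qed
  then have "frechet_derivative \<phi> (at z) = (\<lambda>v. gradient \<phi> z \<bullet> v)" by (rule ext)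
  with d show ?thesis by simp
qed

lemma continuous_test_function: "\<phi> \<in> test_functions \<Omega> \<Longrightarrow> continuous_on S \<phi>"
  using has_derivative_continuous[OF test_function_derivative]
  by (blast intro: continuous_at_imp_continuous_on)

lemma continuous_gradient:
  assumes "\<phi> \<in> test_functions \<Omega>"
  shows "continuous_on S (gradient \<phi>)"
proof -
  have "Ck (Suc 0) \<phi>" using assms by (auto simp: test_functions_def)
  then have "continuous_on UNIV (gradient \<phi>)"
    unfolding gradient_def by (auto intro!: continuous_intros)
  then show ?thesis using continuous_on_subset by blast
qed

lemma gradient_outside:
  assumes "\<phi> \<in> test_functions \<Omega>" "z \<notin> closure {z. \<phi> z \<noteq> 0}"
  shows "gradient \<phi> z = 0"
proof -
  have "(\<lambda>v. gradient \<phi> z \<bullet> v) = (\<lambda>_. 0)"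
    using closure_subset[of "{z. \<phi> z \<noteq> 0}"] assms(2)
    by (intro has_derivative_zero_outside[OF test_function_derivative[OF assms(1)] closed_closure]) auto
  from fun_cong[OF this, of "gradient \<phi> z"] show ?thesis by simp
qed

text \<open>Connects the completed measure of the definitions with \<open>lborel\<close>, in which
  the divergence theorem is stated.\<close>

lemma nn_integral_lebesgue_on_borel:
  assumes "S \<in> sets borel" "f \<in> borel_measurable borel"
  shows "(\<integral>\<^sup>+z. f z \<partial>lebesgue_on S) = (\<integral>\<^sup>+z. f z * indicator S z \<partial>lborel)"
  using assms by (simp add: nn_integral_restrict_space nn_integral_completion)

lemma profile_pos: "2 \<le> n \<Longrightarrow> 0 \<le> e \<Longrightarrow> 0 < t \<Longrightarrow> 0 < profile n e t"
  using hardy_c[of n] by (auto simp: profile_def pert_def intro!: zero_less_power mult_pos_pos divide_pos_pos add_pos_nonneg)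

text \<open>Near the pole \<open>G\<close> is large, so \<open>cut d\<close> annihilates the profile
  there. The base of the power is at most 2 / t, hence below both 1 and d for large t.\<close>

lemma profile_eventually_small:
  assumes "2 \<le> n" "0 \<le> e" "e \<le> 1" "0 < d"
  obtains M where "0 < M" "\<And>t. M \<le> t \<Longrightarrow> profile n e t \<le> d"
proof (rule that[of "max 2 (2 / d)"])
  fix t assume t: "max 2 (2 / d) \<le> t"
  then have t': "2 \<le> t" "2 / d \<le> t" by auto
  have "e / (1 + t) \<le> 1 / 1" using assms t' by (intro frac_le) auto
  then have "hardy_c n * pert e t \<le> 1 * 2"
    using assms hardy_c[of n] t' by (intro mult_mono) (auto simp: pert_def)
  then have b: "hardy_c n * pert e t / t \<le> 2 / t" "2 / t \<le> 1" "2 / t \<le> d"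
    using t' assms by (auto simp: field_simps)
  have nn: "0 \<le> hardy_c n * pert e t / t"
    using assms hardy_c[of n] t' by (auto simp: pert_def)
  have "profile n e t \<le> (hardy_c n * pert e t / t) ^ 1"
    unfolding profile_def using nn b assms by (intro power_decreasing) auto
  then show "profile n e t \<le> d" using b by simp
qed simp

lemma profile_continuous: "2 \<le> n \<Longrightarrow> continuous_on {0<..} (profile n e)"
  unfolding profile_def[abs_def] pert_def by (auto intro!: continuous_intros)

lemma profile'_continuous: "2 \<le> n \<Longrightarrow> continuous_on {0<..} (profile' n e)"
  unfolding profile'_def[abs_def] pert_def gain_def by (auto intro!: continuous_intros)

lemma cut_continuous: "continuous_on {0<..} (cut d)" "continuous_on {0<..} (cut' d)"
  unfolding cut_def[abs_def] cut'_def[abs_def] by (auto intro!: continuous_intros)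

text \<open>The numerator in \<open>profile_gain\<close>. It is the sharp constant for e = 0; for e
  > 0 it gains a term linear in e and loses one of order e^2.\<close>

definition remainder_weight :: "nat \<Rightarrow> real \<Rightarrow> real \<Rightarrow> real \<Rightarrow> real" where
  "remainder_weight n C e t = hardy_c n ^ n - C * e\<^sup>2 + (real n - 1) * hardy_c n ^ (n - 1) * e * gain t"

section \<open>The inequality for test functions on \<open>Om\<close>\<close>

context two_poles
begin

definition W :: "'a \<Rightarrow> real" where "W z = (gr z / G z) ^ DIM('a)"

lemma measurable_gr_G [measurable]:
  "gr \<in> borel_measurable borel" "G \<in> borel_measurable borel" "W \<in> borel_measurable borel"
  unfolding gr_def[abs_def] G_def[abs_def] W_def[abs_def] by measurable

text \<open>At the pole, \<open>gr p = 0\<close> and \<open>G p = 0\<close>, because \<open>x / 0 = 0\<close> and \<open>ln 0 = 0\<close>.\<close>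

lemma W_p: "W p = 0" using dim2 by (simp add: W_def gr_def)

lemma W_nonneg: "z \<in> Om \<Longrightarrow> 0 \<le> W z"
  using G_pos[of z] W_p by (cases "z = p") (auto simp: W_def gr_def)

lemma G_continuous: "continuous_on (Om - {p}) G"
  using G_derivative q_notin_Om has_derivative_continuous
  by (intro continuous_at_imp_continuous_on) blast

lemma dG_continuous: "continuous_on (Om - {p}) dG"
  unfolding dG_def[abs_def] using q_notin_Om by (auto intro!: continuous_intros)

text \<open>Cutting the profile at level \<open>d\<close> makes the test field vanish near the pole,
  so that it has compact support in \<open>Om - {p}\<close> and \<open>flux\<close> applies. The
  price is the factor \<open>cut'\<close> in the weight.\<close>

lemma hardy_test_function_cut:
  fixes \<phi> :: "'a \<Rightarrow> real"
  assumes phi: "\<phi> \<in> test_functions Om" and e: "0 \<le> e" "e \<le> 1" and d: "0 < d"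
    and gain: "\<And>t. 0 < t \<Longrightarrow> remainder_weight DIM('a) C e t / t ^ DIM('a)
      \<le> - profile' DIM('a) e t - (real DIM('a) - 1) * (hardy_c DIM('a) * pert e t / t) ^ DIM('a)"
    and pos: "\<And>t. 0 < t \<Longrightarrow> 0 \<le> remainder_weight DIM('a) C e t"
  shows "(\<integral>\<^sup>+z. ennreal (\<bar>\<phi> z\<bar> ^ DIM('a) * W z * remainder_weight DIM('a) C e (G z)
       * cut' d (profile DIM('a) e (G z))) * indicator Om z \<partial>lborel)
    \<le> (\<integral>\<^sup>+z. ennreal (norm (gradient \<phi> z) ^ DIM('a)) \<partial>lborel)"
proof -
  let ?n = "DIM('a)"
  let ?U = "Om - {p}"
  define w where "w z = \<bar>\<phi> z\<bar> ^ ?n * W z * remainder_weight ?n C e (G z) * cut' d (profile ?n e (G z))" for z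
  obtain M where M: "0 < M" "\<And>t. M \<le> t \<Longrightarrow> profile ?n e t \<le> d"
    using profile_eventually_small[OF dim2 e d] by blast
  define S where "S = closure {z. \<phi> z \<noteq> 0}"
  have S: "compact S" "S \<subseteq> Om" "\<And>z. z \<notin> S \<Longrightarrow> \<phi> z = 0"
    using phi closure_subset[of "{z. \<phi> z \<noteq> 0}"] by (auto simp: test_functions_def S_def)
  \<comment> \<open>The second set is the region G <= M, cleared of the quotient: it is closed, and
    it excludes \<open>p\<close> because \<open>p\<close> differs from \<open>q\<close>.\<close>
  define K where "K = S \<inter> {z. norm (z - q) \<le> exp M * norm (z - p)}"
  have K: "compact K" "K \<subseteq> ?U"
    using S pq by (auto simp: K_def intro!: compact_Int_closed closed_Collect_le continuous_intros)
  have U: "z \<noteq> p" "z \<noteq> q" "0 < G z" if "z \<in> ?U" for z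
    using that q_notin_Om G_pos by auto
  have big: "profile ?n e (G z) \<le> d" if "z \<in> S" "z \<notin> K" "z \<noteq> p" for z
  proof -
    have "exp M < norm (z - q) / norm (z - p)"
      using that by (simp add: K_def field_simps)
    then have "ln (exp M) < ln (norm (z - q) / norm (z - p))"
      using less_trans[OF exp_gt_zero] by (intro ln_less_cancel_iff[THEN iffD2]) auto
    then have "M < G z" by (simp add: G_def)
    then show ?thesis using M by simp
  qed
  \<comment> \<open>Default values: \<open>G p = 0\<close>, division by it gives 0, and the exponent
    N - 1 is positive. Thus the cut profile also vanishes at the pole itself.\<close>
  have pw0: "profile ?n e (G p) = 0" using dim2 by (simp add: profile_def G_def)
  define \<zeta> where "\<zeta> z = \<bar>\<phi> z\<bar> ^ ?n * cut d (profile ?n e (G z))" for z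
  define \<zeta>' where "\<zeta>' z v = \<bar>\<phi> z\<bar> ^ ?n * (cut' d (profile ?n e (G z)) * (profile' ?n e (G z) * (dG z \<bullet> v))) +
     real ?n * (\<bar>\<phi> z\<bar> ^ (?n - 2) * \<phi> z) * (gradient \<phi> z \<bullet> v) * cut d (profile ?n e (G z))" for z v
  have der: "(\<zeta> has_derivative \<zeta>' z) (at z)" if "z \<in> ?U" for z
  proof -
    have 1: "((\<lambda>z. \<bar>\<phi> z\<bar> ^ ?n) has_derivative
        (\<lambda>v. real ?n * (\<bar>\<phi> z\<bar> ^ (?n - 2) * \<phi> z) * (gradient \<phi> z \<bullet> v))) (at z)"
      using DERIV_compose_FDERIV[OF abs_power_derivative[OF dim2] test_function_derivative[OF phi]]
      by (simp add: mult.commute)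
    have 2: "((\<lambda>z. cut d (profile ?n e (G z))) has_derivative
        (\<lambda>v. (dG z \<bullet> v) * (cut' d (profile ?n e (G z)) * profile' ?n e (G z)))) (at z)"
      by (rule DERIV_compose_FDERIV[OF _ G_derivative[OF U(1,2)[OF that]]])
        (intro DERIV_chain2[OF cut_derivative] profile_derivative profile_pos dim2 e U(3)[OF that])
    show ?thesis unfolding \<zeta>_def[abs_def] \<zeta>'_def
      by (rule has_derivative_eq_rhs[OF has_derivative_mult[OF 1 2]]) (simp add: fun_eq_iff)
  qed
  have cont: "continuous_on ?U (\<lambda>z. \<zeta>' z b)" for b
  proof -
    have g: "G ` ?U \<subseteq> {0<..}" using U by auto
    have c1: "continuous_on ?U (\<lambda>z. profile ?n e (G z))" "continuous_on ?U (\<lambda>z. profile' ?n e (G z))"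
      by (rule continuous_on_compose2[OF profile_continuous G_continuous g] continuous_on_compose2[OF profile'_continuous G_continuous g] dim2)+
    have g2: "(\<lambda>z. profile ?n e (G z)) ` ?U \<subseteq> {0<..}" using U profile_pos[OF dim2 e(1)] by auto
    have c2: "continuous_on ?U (\<lambda>z. cut d (profile ?n e (G z)))" "continuous_on ?U (\<lambda>z. cut' d (profile ?n e (G z)))"
      by (rule continuous_on_compose2[OF cut_continuous(1) c1(1) g2] continuous_on_compose2[OF cut_continuous(2) c1(1) g2])+
    show ?thesis unfolding \<zeta>'_def
      by (intro continuous_intros c1 c2 dG_continuous continuous_test_function[OF phi] continuous_gradient[OF phi])
  qed
  have z0: "\<zeta> z = 0" if "z \<notin> K" for z
  proof (cases "z \<in> S")
    case True
    show ?thesis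
    proof (cases "z = p")
      case True
      then show ?thesis using pw0 d by (simp add: \<zeta>_def cut_eq_0)
    next
      case False
      then show ?thesis using big[OF \<open>z \<in> S\<close> that] by (simp add: \<zeta>_def cut_eq_0)
    qed
  qed (use S dim2 in \<open>simp add: \<zeta>_def\<close>)
  note fl = flux[OF der cont K z0]
  have w0: "w z = 0" if "z \<notin> K" for z
  proof (cases "z \<in> S")
    case True
    show ?thesis
    proof (cases "z = p")
      case True
      then show ?thesis using W_p by (simp add: w_def)
    next
      case False
      then show ?thesis using big[OF \<open>z \<in> S\<close> that] by (simp add: w_def cut_eq_0)
    qed
  qed (use S dim2 in \<open>simp add: w_def\<close>)
  \<comment> \<open>The inequality before integration: the weighted term is at most |grad phi|^N
    minus the divergence of \<open>\<zeta> Y\<close>. The derivative of the profile supplies the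
    weight, Young's inequality absorbs the mixed term.\<close>
  have main: "0 \<le> w z \<and> w z \<le> norm (gradient \<phi> z) ^ ?n - \<zeta>' z (Y z)" if "z \<in> K" for z
  proof -
    have zU: "z \<in> ?U" using that K by auto
    note u = U[OF zU]
    define t F P where "t = G z" and "F = hardy_c ?n * pert e t / t" and "P = profile' ?n e t"
    have F: "0 \<le> F" using hardy_c[OF dim2] u e by (auto simp: F_def pert_def t_def)
    have pwF: "profile ?n e t = F ^ (?n - 1)" by (simp add: profile_def F_def)
    have "0 < profile ?n e t" using profile_pos[OF dim2 e(1)] u by (simp add: t_def)
    then obtain y where y: "0 \<le> y" "y \<le> 1" "cut d (profile ?n e t) = y\<^sup>2 * F ^ (?n - 1)"
      "cut' d (profile ?n e t) = y * (2 - y)"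
      using cut_bounds[OF d] unfolding pwF by blast
    have g: "0 \<le> gr z" by (simp add: gr_def)
    have R: "0 \<le> remainder_weight ?n C e t" using pos u by (simp add: t_def)
    have CS: "\<bar>gradient \<phi> z \<bullet> Y z\<bar> \<le> norm (gradient \<phi> z) * gr z ^ (?n - 1)"
      using Cauchy_Schwarz_ineq2[of "gradient \<phi> z" "Y z"] norm_Y[OF u(1,2)] by simp
    note yp = young_pointwise[OF dim2 y(1,2) abs_ge_zero norm_ge_zero F g CS refl[of "\<bar>\<phi> z\<bar>"]]
    have w: "w z = (\<bar>\<phi> z\<bar> * gr z) ^ ?n * (y * (2 - y)) * (remainder_weight ?n C e t / t ^ ?n)"
      unfolding w_def t_def[symmetric] y W_def by (simp add: power_mult_distrib power_divide)
    have "w z \<le> (\<bar>\<phi> z\<bar> * gr z) ^ ?n * (y * (2 - y)) * (- P - (real ?n - 1) * F ^ ?n)"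
      unfolding w P_def F_def using y g gain[of t] u by (intro mult_left_mono) (auto simp: t_def)
    also have "\<dots> = - (\<bar>\<phi> z\<bar> ^ ?n * (y * (2 - y) * (P * gr z ^ ?n)))
       - (real ?n - 1) * (\<bar>\<phi> z\<bar> * gr z * F) ^ ?n * (y * (2 - y))"
      by (simp add: power_mult_distrib algebra_simps)
    also have "\<dots> \<le> norm (gradient \<phi> z) ^ ?n - \<zeta>' z (Y z)"
      using yp unfolding \<zeta>'_def t_def[symmetric] y dG_inner_Y[OF u(1,2)] P_def[symmetric] by linarith
    finally have "w z \<le> norm (gradient \<phi> z) ^ ?n - \<zeta>' z (Y z)" .
    moreover have "0 \<le> w z" unfolding w using y g R u by (intro mult_nonneg_nonneg divide_nonneg_nonneg) (auto simp: t_def)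
    ultimately show ?thesis by simp
  qed
  have Ig: "integrable lborel (\<lambda>z. indicator K z * norm (gradient \<phi> z) ^ ?n)"
  proof -
    have "continuous_on K (\<lambda>z. norm (gradient \<phi> z) ^ ?n)"
      by (intro continuous_intros continuous_gradient[OF phi])
    from borel_integrable_compact[OF K(1) this] show ?thesis by simp
  qed
  \<comment> \<open>\<open>?h\<close> is the nonnegative upper bound from \<open>main\<close>. By
    \<open>flux\<close> its second term integrates to 0, which leaves the gradient integral over
    \<open>K\<close>.\<close>
  let ?h = "\<lambda>z. indicator K z * norm (gradient \<phi> z) ^ ?n - indicator K z * \<zeta>' z (Y z)"
  have h0: "0 \<le> ?h z" for z using main[of z] by (cases "z \<in> K") auto
  have "(\<integral>\<^sup>+z. ennreal (w z) * indicator Om z \<partial>lborel) \<le> (\<integral>\<^sup>+z. ennreal (?h z) \<partial>lborel)"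
    using main w0 by (intro nn_integral_mono) (auto simp: indicator_def ennreal_leI)
  also have "\<dots> = ennreal (\<integral>z. ?h z \<partial>lborel)"
    using Ig fl(1) h0 by (intro nn_integral_eq_integral) auto
  also have "\<dots> = ennreal (\<integral>z. indicator K z * norm (gradient \<phi> z) ^ ?n \<partial>lborel)"
    using Ig fl by simp
  also have "\<dots> = (\<integral>\<^sup>+z. ennreal (indicator K z * norm (gradient \<phi> z) ^ ?n) \<partial>lborel)"
    using Ig by (intro nn_integral_eq_integral[symmetric]) auto
  also have "\<dots> \<le> (\<integral>\<^sup>+z. ennreal (norm (gradient \<phi> z) ^ ?n) \<partial>lborel)"
    by (intro nn_integral_mono) (auto simp: indicator_def)
  finally show ?thesis unfolding w_def .
qed

text \<open>Fatou's lemma along the cut levels 1 / (j + 1), for which the factor \<open>cut'\<close>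
  tends to 1 on \<open>Om - {p}\<close>; at \<open>p\<close> the weight is 0.\<close>

lemma hardy_test_function:
  fixes \<phi> :: "'a \<Rightarrow> real"
  assumes phi: "\<phi> \<in> test_functions Om" and e: "0 \<le> e" "e \<le> 1"
    and gain: "\<And>t. 0 < t \<Longrightarrow> remainder_weight DIM('a) C e t / t ^ DIM('a)
      \<le> - profile' DIM('a) e t - (real DIM('a) - 1) * (hardy_c DIM('a) * pert e t / t) ^ DIM('a)"
    and pos: "\<And>t. 0 < t \<Longrightarrow> 0 \<le> remainder_weight DIM('a) C e t"
  shows "(\<integral>\<^sup>+z. ennreal (\<bar>\<phi> z\<bar> ^ DIM('a) * W z * remainder_weight DIM('a) C e (G z)) \<partial>lebesgue_on Om)
    \<le> (\<integral>\<^sup>+z. ennreal (norm (gradient \<phi> z) ^ DIM('a)) \<partial>lebesgue_on Om)"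
proof -
  let ?n = "DIM('a)"
  let ?A = "(\<integral>\<^sup>+z. ennreal (norm (gradient \<phi> z) ^ ?n) \<partial>lborel)"
  define v where "v z = \<bar>\<phi> z\<bar> ^ ?n * W z * remainder_weight ?n C e (G z)" for z
  define w where "w j z = ennreal (v z * cut' (1 / real (Suc j)) (profile ?n e (G z))) * indicator Om z" for j z
  have [measurable]: "\<phi> \<in> borel_measurable borel" "gradient \<phi> \<in> borel_measurable borel"
    using continuous_test_function[OF phi] continuous_gradient[OF phi] borel_measurable_continuous_onI by blast+
  have [measurable]: "Om \<in> sets borel" using open_Om by simp
  have vm [measurable]: "v \<in> borel_measurable borel"
    unfolding v_def[abs_def] remainder_weight_def gain_def by measurable
  have [measurable]: "w j \<in> borel_measurable lborel" for j
    unfolding w_def[abs_def] cut'_def profile_def pert_def by measurable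
  have lim: "(\<lambda>j. w j z) \<longlonglongrightarrow> ennreal (v z) * indicator Om z" for z
  proof (cases "z \<in> Om - {p}")
    case True
    then have "0 < profile ?n e (G z)" using G_pos profile_pos[OF dim2 e(1)] by auto
    from cut'_tendsto[OF this] have "(\<lambda>j. v z * cut' (1 / real (Suc j)) (profile ?n e (G z))) \<longlonglongrightarrow> v z * 1"
      by (rule tendsto_mult_left)
    then show ?thesis using True by (simp add: w_def tendsto_ennrealI)
  next
    case False
    then show ?thesis using W_p by (cases "z = p") (auto simp: w_def v_def)
  qed
  have "(\<integral>\<^sup>+z. ennreal (v z) * indicator Om z \<partial>lborel) = (\<integral>\<^sup>+z. liminf (\<lambda>j. w j z) \<partial>lborel)"
    using lim_imp_Liminf[OF sequentially_bot lim] by simp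
  also have "\<dots> \<le> liminf (\<lambda>j. \<integral>\<^sup>+z. w j z \<partial>lborel)"
    by (rule nn_integral_liminf) simp
  also have "\<dots> \<le> liminf (\<lambda>j. ?A)"
    using hardy_test_function_cut[OF phi e _ gain pos] unfolding w_def v_def
    by (intro Liminf_mono always_eventually allI) auto
  also have "\<dots> = ?A" by (simp add: Liminf_const)
  finally have le: "(\<integral>\<^sup>+z. ennreal (v z) * indicator Om z \<partial>lborel) \<le> ?A" .
  have out: "gradient \<phi> z = 0" if "z \<notin> Om" for z
    using phi that by (intro gradient_outside[OF phi]) (auto simp: test_functions_def)
  have "?A = (\<integral>\<^sup>+z. ennreal (norm (gradient \<phi> z) ^ ?n) * indicator Om z \<partial>lborel)"
    using out dim2 by (intro nn_integral_cong) (auto simp: indicator_def)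
  then show ?thesis using le unfolding v_def[symmetric]
    by (simp add: nn_integral_lebesgue_on_borel)
qed

end

section \<open>Passage to the completion\<close>

text \<open>Convexity of the n-th power at x + y = (1 - \<theta>) (x / (1 - \<theta>)) + \<theta> (y
  / \<theta>). As \<theta> tends to 0 the coefficient of x^n tends to 1, so the estimate can serve
  as the triangle inequality in L^n.\<close>

lemma power_add_le_weighted:
  fixes x y \<theta> :: real
  assumes "0 \<le> x" "0 \<le> y" "0 < \<theta>" "\<theta> < 1" "0 < n"
  shows "(x + y) ^ n \<le> (1 / (1 - \<theta>) ^ (n - 1)) * x ^ n + (1 / \<theta> ^ (n - 1)) * y ^ n"
proof -
  have "convex_on {0::real..} (\<lambda>x. x ^ n)"
    using convex_power_odd[of n] convex_on_subset[OF convex_power_even[of n] subset_UNIV]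
    by (cases "even n") auto
  from convex_onD[OF this, of \<theta> "x / (1 - \<theta>)" "y / \<theta>"]
  have "(x + y) ^ n \<le> (1 - \<theta>) * (x / (1 - \<theta>)) ^ n + \<theta> * (y / \<theta>) ^ n"
    using assms by simp
  also have "\<dots> = (1 / (1 - \<theta>) ^ (n - 1)) * x ^ n + (1 / \<theta> ^ (n - 1)) * y ^ n"
    using assms by (cases n) (auto simp: power_divide)
  finally show ?thesis .
qed

lemma nn_integral_power_add_le:
  fixes f g :: "'a \<Rightarrow> 'b::real_normed_vector"
  assumes [measurable]: "(\<lambda>z. norm (f z)) \<in> borel_measurable M" "(\<lambda>z. norm (h z - f z)) \<in> borel_measurable M"
    and \<theta>: "0 < \<theta>" "\<theta> < 1" and n: "0 < n"
  shows "(\<integral>\<^sup>+z. ennreal (norm (h z) ^ n) \<partial>M) \<le>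
    ennreal (1 / (1 - \<theta>) ^ (n - 1)) * (\<integral>\<^sup>+z. ennreal (norm (f z) ^ n) \<partial>M) +
    ennreal (1 / \<theta> ^ (n - 1)) * (\<integral>\<^sup>+z. ennreal (norm (h z - f z) ^ n) \<partial>M)"
proof -
  have "norm (h z) ^ n \<le> (1 / (1 - \<theta>) ^ (n - 1)) * norm (f z) ^ n + (1 / \<theta> ^ (n - 1)) * norm (h z - f z) ^ n" for z
  proof -
    have "norm (h z) \<le> norm (f z) + norm (h z - f z)"
      using norm_triangle_ineq[of "f z" "h z - f z"] by simp
    then have "norm (h z) ^ n \<le> (norm (f z) + norm (h z - f z)) ^ n"
      by (intro power_mono) auto
    also have "\<dots> \<le> (1 / (1 - \<theta>) ^ (n - 1)) * norm (f z) ^ n + (1 / \<theta> ^ (n - 1)) * norm (h z - f z) ^ n"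
      using \<theta> n by (intro power_add_le_weighted) auto
    finally show ?thesis .
  qed
  then have "(\<integral>\<^sup>+z. ennreal (norm (h z) ^ n) \<partial>M) \<le>
    (\<integral>\<^sup>+z. ennreal (1 / (1 - \<theta>) ^ (n - 1)) * ennreal (norm (f z) ^ n)
      + ennreal (1 / \<theta> ^ (n - 1)) * ennreal (norm (h z - f z) ^ n) \<partial>M)"
    using \<theta> by (intro nn_integral_mono)
      (simp add: ennreal_mult[symmetric] ennreal_plus[symmetric] ennreal_leI del: ennreal_plus)
  also have "\<dots> = ennreal (1 / (1 - \<theta>) ^ (n - 1)) * (\<integral>\<^sup>+z. ennreal (norm (f z) ^ n) \<partial>M) +
    ennreal (1 / \<theta> ^ (n - 1)) * (\<integral>\<^sup>+z. ennreal (norm (h z - f z) ^ n) \<partial>M)"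
    by (simp add: nn_integral_add nn_integral_cmult)
  finally show ?thesis .
qed

text \<open>Convergence in \<open>ennreal\<close> makes the integrals finite only from some index
  \<open>N\<close> on; the shifted sequence is integrable, and \<open>tendsto_L1_AE_subseq\<close>
  applies to it.\<close>

lemma tendsto_L1_AE_subseq_nn_integral:
  fixes f :: "nat \<Rightarrow> 'a \<Rightarrow> real"
  assumes [measurable]: "\<And>n. f n \<in> borel_measurable M"
    and lim: "(\<lambda>n. \<integral>\<^sup>+z. ennreal \<bar>f n z\<bar> \<partial>M) \<longlonglongrightarrow> 0"
  shows "\<exists>r::nat \<Rightarrow> nat. strict_mono r \<and> (AE z in M. (\<lambda>n. f (r n) z) \<longlonglongrightarrow> 0)"
proof -
  have "\<forall>\<^sub>F n in sequentially. (\<integral>\<^sup>+z. ennreal \<bar>f n z\<bar> \<partial>M) < 1"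
    using order_tendstoD(2)[OF lim] by simp
  then obtain N where N: "\<And>n. N \<le> n \<Longrightarrow> (\<integral>\<^sup>+z. ennreal \<bar>f n z\<bar> \<partial>M) < 1"
    unfolding eventually_sequentially by blast
  have int: "integrable M (f (n + N))" for n
    using N[of "n + N"] by (intro integrableI_bounded) (auto intro: less_trans)
  have "(\<lambda>n. enn2real (\<integral>\<^sup>+z. ennreal \<bar>f (n + N) z\<bar> \<partial>M)) \<longlonglongrightarrow> 0"
    using LIMSEQ_ignore_initial_segment[OF lim, of N] by (intro tendsto_enn2real) auto
  then have "(\<lambda>n. \<integral>z. norm (f (n + N) z) \<partial>M) \<longlonglongrightarrow> 0"
    by (simp add: integral_eq_nn_integral)
  from tendsto_L1_AE_subseq[OF int this]
  obtain r :: "nat \<Rightarrow> nat" where "strict_mono r" "AE z in M. (\<lambda>n. f (r n + N) z) \<longlonglongrightarrow> 0" by blast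
  then show ?thesis by (intro exI[of _ "\<lambda>n. r n + N"]) (auto simp: strict_mono_def)
qed

text \<open>Approximating sequences control the function only on compact sets. Fatou's lemma along a
  compact exhaustion carries a uniform bound to the whole domain.\<close>

lemma nn_integral_le_by_compact_exhaustion:
  fixes f :: "'a::euclidean_space \<Rightarrow> ennreal"
  assumes "open \<Omega>" and f: "f \<in> borel_measurable (lebesgue_on \<Omega>)"
    and le: "\<And>K. compact K \<Longrightarrow> K \<subseteq> \<Omega> \<Longrightarrow> (\<integral>\<^sup>+z. f z \<partial>lebesgue_on K) \<le> A"
  shows "(\<integral>\<^sup>+z. f z \<partial>lebesgue_on \<Omega>) \<le> A"
proof -
  obtain C where C: "\<And>n. compact (C n)" "\<And>n. C n \<subseteq> \<Omega>" "\<And>n. C n \<subseteq> interior (C (Suc n))" "\<Union>(range C) = \<Omega>"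
    using open_Union_compact_subsets[OF \<open>open \<Omega>\<close>] by metis
  have inc: "incseq C"
    using C(3) interior_subset by (intro incseq_SucI) blast
  have S: "C n \<in> sets lebesgue" for n
    using C(1) by (intro lmeasurable_compact[THEN fmeasurableD])
  have lim: "(\<lambda>n. f z * indicator (C n) z) \<longlonglongrightarrow> f z * indicator \<Omega> z" for z
  proof (cases "z \<in> \<Omega>")
    case True
    then obtain k where "z \<in> C k" using C(4) by blast
    then have "\<forall>n\<ge>k. z \<in> C n" using inc by (meson incseqD subsetD)
    then show ?thesis using True
      by (intro tendsto_eventually) (auto simp: eventually_sequentially indicator_def intro!: exI[of _ k])
  next
    case False
    then have "z \<notin> C n" for n using C(2) by blast
    then show ?thesis using False by simp
  qed
  have "(\<integral>\<^sup>+z. f z \<partial>lebesgue_on \<Omega>) = (\<integral>\<^sup>+z. liminf (\<lambda>n. f z * indicator (C n) z) \<partial>lebesgue)"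
    using \<open>open \<Omega>\<close> lim_imp_Liminf[OF sequentially_bot lim]
    by (simp add: nn_integral_restrict_space)
  also have "\<dots> \<le> liminf (\<lambda>n. \<integral>\<^sup>+z. f z * indicator (C n) z \<partial>lebesgue)"
    using measurable_restrict_mono[OF f C(2)] S
    by (intro nn_integral_liminf) (simp add: borel_measurable_restrict_space_iff_ennreal)
  also have "\<dots> = liminf (\<lambda>n. \<integral>\<^sup>+z. f z \<partial>lebesgue_on (C n))"
    using S by (simp add: nn_integral_restrict_space)
  also have "\<dots> \<le> liminf (\<lambda>n. A)"
    using le C by (intro Liminf_mono always_eventually) auto
  finally show ?thesis by (simp add: Liminf_const)
qed

lemma borel_measurable_lebesgue_on: "f \<in> borel_measurable borel \<Longrightarrow> f \<in> borel_measurable (lebesgue_on S)"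
  by (intro measurable_restrict_space1 measurable_completion) simp

lemma test_function_hom_sobolev0:
  assumes "\<phi> \<in> test_functions \<Omega>"
  shows "hom_sobolev0 \<Omega> r \<phi> (gradient \<phi>)"
proof -
  have "\<phi> \<in> borel_measurable borel" "gradient \<phi> \<in> borel_measurable borel"
    using continuous_test_function[OF assms] continuous_gradient[OF assms] borel_measurable_continuous_onI by blast+
  then show ?thesis unfolding hom_sobolev0_def
    using assms by (intro conjI exI[of _ "\<lambda>_. \<phi>"]) (auto intro: borel_measurable_lebesgue_on)
qed

text \<open>For 0 < n the real power of the definition agrees with the natural one even at
  0.\<close>

lemma hom_sobolev0_gradient_sequence:
  fixes g :: "'a::euclidean_space \<Rightarrow> 'a"
  assumes "hom_sobolev0 \<Omega> (real n) u g" "0 < n"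
  obtains \<phi> where "\<And>j. \<phi> j \<in> test_functions \<Omega>"
    "(\<lambda>j. \<integral>\<^sup>+z. ennreal (norm (gradient (\<phi> j) z - g z) ^ n) \<partial>lebesgue_on \<Omega>) \<longlonglongrightarrow> 0"
    "\<And>K. compact K \<Longrightarrow> K \<subseteq> \<Omega> \<Longrightarrow> (\<lambda>j. \<integral>\<^sup>+z. ennreal \<bar>\<phi> j z - u z\<bar> \<partial>lebesgue_on K) \<longlonglongrightarrow> 0"
  using assms unfolding hom_sobolev0_def by (auto simp: powr_realpow' image_subset_iff)

text \<open>On a compact set a subsequence of the approximating test functions converges almost
  everywhere, so the left side passes to the limit by Fatou's lemma. The right side does so because
  the gradients converge in L^n. Exhausting the domain finishes the proof.\<close>

lemma hom_sobolev0_weighted_inequality: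
  fixes u :: "'a::euclidean_space \<Rightarrow> real"
  assumes H: "hom_sobolev0 \<Omega> (real n) u g" and n: "0 < n" and "open \<Omega>"
    and v [measurable]: "v \<in> borel_measurable borel"
    and test: "\<And>\<phi>. \<phi> \<in> test_functions \<Omega> \<Longrightarrow>
      (\<integral>\<^sup>+z. ennreal (\<bar>\<phi> z\<bar> ^ n * v z) \<partial>lebesgue_on \<Omega>)
      \<le> (\<integral>\<^sup>+z. ennreal (norm (gradient \<phi> z) ^ n) \<partial>lebesgue_on \<Omega>)"
  shows "(\<integral>\<^sup>+z. ennreal (\<bar>u z\<bar> ^ n * v z) \<partial>lebesgue_on \<Omega>)
      \<le> (\<integral>\<^sup>+z. ennreal (norm (g z) ^ n) \<partial>lebesgue_on \<Omega>)"
proof -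
  define A where "A = (\<integral>\<^sup>+z. ennreal (norm (g z) ^ n) \<partial>lebesgue_on \<Omega>)"
  have um: "u \<in> borel_measurable (lebesgue_on \<Omega>)" and gm [measurable]: "g \<in> borel_measurable (lebesgue_on \<Omega>)"
    using H by (auto simp: hom_sobolev0_def)
  obtain \<phi> where phi: "\<And>j. \<phi> j \<in> test_functions \<Omega>"
    and D: "(\<lambda>j. \<integral>\<^sup>+z. ennreal (norm (gradient (\<phi> j) z - g z) ^ n) \<partial>lebesgue_on \<Omega>) \<longlonglongrightarrow> 0"
    and L: "\<And>K. compact K \<Longrightarrow> K \<subseteq> \<Omega> \<Longrightarrow> (\<lambda>j. \<integral>\<^sup>+z. ennreal \<bar>\<phi> j z - u z\<bar> \<partial>lebesgue_on K) \<longlonglongrightarrow> 0"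
    using hom_sobolev0_gradient_sequence[OF H n] by blast
  have pm: "\<phi> j \<in> borel_measurable borel" "gradient (\<phi> j) \<in> borel_measurable borel" for j
    using continuous_test_function[OF phi] continuous_gradient[OF phi] borel_measurable_continuous_onI by blast+
  \<comment> \<open>With \<theta> fixed, the distance of the gradients tends to 0 despite its large
    coefficient; the limit \<theta> to 0 is taken afterwards.\<close>
  have K: "(\<integral>\<^sup>+z. ennreal (\<bar>u z\<bar> ^ n * v z) \<partial>lebesgue_on K) \<le> ennreal (1 / (1 - \<theta>) ^ (n - 1)) * A"
    if K: "compact K" "K \<subseteq> \<Omega>" and \<theta>: "0 < \<theta>" "\<theta> < 1" for K \<theta>
  proof -
    have [measurable]: "u \<in> borel_measurable (lebesgue_on K)"
      using measurable_restrict_mono[OF um K(2)] .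
    have [measurable]: "\<phi> j \<in> borel_measurable (lebesgue_on K)" "v \<in> borel_measurable (lebesgue_on K)" for j
      using pm(1) v by (auto intro!: borel_measurable_lebesgue_on)
    obtain r :: "nat \<Rightarrow> nat" where rm: "strict_mono r" and r: "AE z in lebesgue_on K. (\<lambda>j. \<phi> (r j) z - u z) \<longlonglongrightarrow> 0"
      using tendsto_L1_AE_subseq_nn_integral[OF _ L[OF K]] by fastforce
    define d where "d j = (\<integral>\<^sup>+z. ennreal (norm (gradient (\<phi> j) z - g z) ^ n) \<partial>lebesgue_on \<Omega>)" for j
    have AE: "AE z in lebesgue_on K. ennreal (\<bar>u z\<bar> ^ n * v z) \<le> liminf (\<lambda>j. ennreal (\<bar>\<phi> (r j) z\<bar> ^ n * v z))"
      using r
    proof eventually_elim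
      case (elim z)
      then have "(\<lambda>j. \<phi> (r j) z) \<longlonglongrightarrow> u z" by (simp add: LIM_zero_iff)
      then have "(\<lambda>j. ennreal (\<bar>\<phi> (r j) z\<bar> ^ n * v z)) \<longlonglongrightarrow> ennreal (\<bar>u z\<bar> ^ n * v z)"
        by (intro tendsto_intros)
      from lim_imp_Liminf[OF sequentially_bot this] show ?case by simp
    qed
    have "(\<integral>\<^sup>+z. ennreal (\<bar>u z\<bar> ^ n * v z) \<partial>lebesgue_on K)
      \<le> (\<integral>\<^sup>+z. liminf (\<lambda>j. ennreal (\<bar>\<phi> (r j) z\<bar> ^ n * v z)) \<partial>lebesgue_on K)"
      using AE by (rule nn_integral_mono_AE)
    also have "\<dots> \<le> liminf (\<lambda>j. \<integral>\<^sup>+z. ennreal (\<bar>\<phi> (r j) z\<bar> ^ n * v z) \<partial>lebesgue_on K)"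
      by (rule nn_integral_liminf) measurable
    also have "\<dots> \<le> liminf (\<lambda>j. ennreal (1 / (1 - \<theta>) ^ (n - 1)) * A + ennreal (1 / \<theta> ^ (n - 1)) * d (r j))"
    proof (intro Liminf_mono always_eventually allI)
      fix j
      have [measurable]: "gradient (\<phi> i) \<in> borel_measurable (lebesgue_on \<Omega>)" for i
        using pm(2) by (rule borel_measurable_lebesgue_on)
      have "(\<integral>\<^sup>+z. ennreal (\<bar>\<phi> (r j) z\<bar> ^ n * v z) \<partial>lebesgue_on K)
         \<le> (\<integral>\<^sup>+z. ennreal (\<bar>\<phi> (r j) z\<bar> ^ n * v z) \<partial>lebesgue_on \<Omega>)"
        using K(2) \<open>open \<Omega>\<close> fmeasurableD[OF lmeasurable_compact[OF K(1)]]
        by (auto simp: nn_integral_restrict_space indicator_def intro!: nn_integral_mono)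
      also have "\<dots> \<le> (\<integral>\<^sup>+z. ennreal (norm (gradient (\<phi> (r j)) z) ^ n) \<partial>lebesgue_on \<Omega>)"
        by (rule test[OF phi])
      also have "\<dots> \<le> ennreal (1 / (1 - \<theta>) ^ (n - 1)) * A + ennreal (1 / \<theta> ^ (n - 1)) * d (r j)"
        unfolding A_def d_def using \<theta> n by (intro nn_integral_power_add_le) measurable
      finally show "(\<integral>\<^sup>+z. ennreal (\<bar>\<phi> (r j) z\<bar> ^ n * v z) \<partial>lebesgue_on K)
        \<le> ennreal (1 / (1 - \<theta>) ^ (n - 1)) * A + ennreal (1 / \<theta> ^ (n - 1)) * d (r j)" .
    qed
    also have "\<dots> = ennreal (1 / (1 - \<theta>) ^ (n - 1)) * A + ennreal (1 / \<theta> ^ (n - 1)) * 0"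
    proof (rule lim_imp_Liminf[OF sequentially_bot])
      have "(\<lambda>j. d (r j)) \<longlonglongrightarrow> 0"
        using LIMSEQ_subseq_LIMSEQ[OF D rm] by (simp add: d_def o_def)
      then show "(\<lambda>j. ennreal (1 / (1 - \<theta>) ^ (n - 1)) * A + ennreal (1 / \<theta> ^ (n - 1)) * d (r j))
          \<longlonglongrightarrow> ennreal (1 / (1 - \<theta>) ^ (n - 1)) * A + ennreal (1 / \<theta> ^ (n - 1)) * 0"
        by (intro tendsto_add tendsto_const ennreal_tendsto_cmult) auto
    qed
    finally show ?thesis by simp
  qed
  have K': "(\<integral>\<^sup>+z. ennreal (\<bar>u z\<bar> ^ n * v z) \<partial>lebesgue_on K) \<le> A" if "compact K" "K \<subseteq> \<Omega>" for K
  \<comment> \<open>Multiplication by \<open>A\<close> is continuous on \<open>ennreal\<close> only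
    for finite \<open>A\<close>; the infinite case is trivial.\<close>
  proof (cases "A = top")
    case False
    define \<theta> where "\<theta> k = 1 / real (Suc (Suc k))" for k
    have "(\<lambda>k. inverse (real (Suc (Suc k)))) \<longlonglongrightarrow> 0"
      using LIMSEQ_Suc[OF LIMSEQ_inverse_real_of_nat] .
    then have "\<theta> \<longlonglongrightarrow> 0" unfolding \<theta>_def by (simp add: inverse_eq_divide)
    then have "(\<lambda>k. 1 / (1 - \<theta> k) ^ (n - 1)) \<longlonglongrightarrow> 1 / (1 - 0) ^ (n - 1)"
      by (intro tendsto_intros) auto
    then have "(\<lambda>k. A * ennreal (1 / (1 - \<theta> k) ^ (n - 1))) \<longlonglongrightarrow> A * ennreal (1 / (1 - 0) ^ (n - 1))"
      using False by (intro ennreal_tendsto_cmult tendsto_ennrealI) (simp add: less_top)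
    then have "(\<lambda>k. A * ennreal (1 / (1 - \<theta> k) ^ (n - 1))) \<longlonglongrightarrow> A" by simp
    moreover have "(\<integral>\<^sup>+z. ennreal (\<bar>u z\<bar> ^ n * v z) \<partial>lebesgue_on K) \<le> A * ennreal (1 / (1 - \<theta> k) ^ (n - 1))" for k
      using K[OF that, of "\<theta> k"] by (simp add: \<theta>_def mult.commute)
    ultimately show ?thesis by (intro LIMSEQ_le_const) auto
  qed simp
  have "(\<lambda>z. ennreal (\<bar>u z\<bar> ^ n * v z)) \<in> borel_measurable (lebesgue_on \<Omega>)"
    using um borel_measurable_lebesgue_on[OF v] by measurable
  from nn_integral_le_by_compact_exhaustion[OF \<open>open \<Omega>\<close> this K'] show ?thesis unfolding A_def .
qed

text \<open>The field \<open>g\<close> lies at finite L^n distance from the gradient of one test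
  function, which is bounded with compact support.\<close>

lemma hom_sobolev0_gradient_finite:
  fixes u :: "'a::euclidean_space \<Rightarrow> real"
  assumes H: "hom_sobolev0 \<Omega> (real n) u g" and n: "0 < n" and "open \<Omega>"
  shows "(\<integral>\<^sup>+z. ennreal (norm (g z) ^ n) \<partial>lebesgue_on \<Omega>) < top"
proof -
  have gm [measurable]: "g \<in> borel_measurable (lebesgue_on \<Omega>)"
    using H by (auto simp: hom_sobolev0_def)
  obtain \<phi> where phi: "\<And>j. \<phi> j \<in> test_functions \<Omega>"
    and D: "(\<lambda>j. \<integral>\<^sup>+z. ennreal (norm (gradient (\<phi> j) z - g z) ^ n) \<partial>lebesgue_on \<Omega>) \<longlonglongrightarrow> 0"
    and "\<And>K. compact K \<Longrightarrow> K \<subseteq> \<Omega> \<Longrightarrow> (\<lambda>j. \<integral>\<^sup>+z. ennreal \<bar>\<phi> j z - u z\<bar> \<partial>lebesgue_on K) \<longlonglongrightarrow> 0"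
    using hom_sobolev0_gradient_sequence[OF H n] by blast
  obtain j where j: "(\<integral>\<^sup>+z. ennreal (norm (g z - gradient (\<phi> j) z) ^ n) \<partial>lebesgue_on \<Omega>) < top"
    using order_tendstoD(2)[OF D, of top] by (auto simp: eventually_sequentially norm_minus_commute)
  let ?S = "closure {z. \<phi> j z \<noteq> 0}"
  have S: "compact ?S" using phi[of j] by (auto simp: test_functions_def)
  have pm: "gradient (\<phi> j) \<in> borel_measurable borel"
    using continuous_gradient[OF phi] borel_measurable_continuous_onI by blast
  then have [measurable]: "gradient (\<phi> j) \<in> borel_measurable (lebesgue_on \<Omega>)"
    by (rule borel_measurable_lebesgue_on)
  have "integrable lborel (\<lambda>z. norm (gradient (\<phi> j) z) ^ n)"
    using n gradient_outside[OF phi]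
    by (intro integrable_lborel_compact_support[OF _ S] continuous_intros continuous_gradient[OF phi]) auto
  then have "(\<integral>\<^sup>+z. ennreal (norm (gradient (\<phi> j) z) ^ n) \<partial>lborel) < top"
    by (simp add: integrable_iff_bounded)
  moreover have "(\<integral>\<^sup>+z. ennreal (norm (gradient (\<phi> j) z) ^ n) \<partial>lebesgue_on \<Omega>)
      \<le> (\<integral>\<^sup>+z. ennreal (norm (gradient (\<phi> j) z) ^ n) \<partial>lborel)"
    using \<open>open \<Omega>\<close> pm
    by (subst nn_integral_lebesgue_on_borel) (auto simp: indicator_def intro!: nn_integral_mono)
  ultimately have f: "(\<integral>\<^sup>+z. ennreal (norm (gradient (\<phi> j) z) ^ n) \<partial>lebesgue_on \<Omega>) < top"
    by (rule le_less_trans[rotated])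
  have "(\<integral>\<^sup>+z. ennreal (norm (g z) ^ n) \<partial>lebesgue_on \<Omega>) \<le>
    ennreal (1 / (1 - 1/2) ^ (n - 1)) * (\<integral>\<^sup>+z. ennreal (norm (gradient (\<phi> j) z) ^ n) \<partial>lebesgue_on \<Omega>) +
    ennreal (1 / (1/2) ^ (n - 1)) * (\<integral>\<^sup>+z. ennreal (norm (g z - gradient (\<phi> j) z) ^ n) \<partial>lebesgue_on \<Omega>)"
    using n by (intro nn_integral_power_add_le) simp_all
  also have "\<dots> < top" using f j by (simp add: ennreal_mult_less_top)
  finally show ?thesis .
qed

section \<open>The inequality on the completion, and its strictness\<close>

context two_poles
begin

text \<open>The order of quantifiers matters: one \<open>C\<close> serves all \<open>u\<close> and
  all small \<open>e\<close>, so that e can tend to 0 with \<open>u\<close> fixed. The bound on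
  \<open>C * e\<^sup>2\<close> keeps the weight nonnegative.\<close>

lemma hardy_sobolev_remainder:
  "\<exists>C\<ge>0. \<forall>u g e. hom_sobolev0 Om (real DIM('a)) u g \<longrightarrow> 0 \<le> e \<longrightarrow> e \<le> 1 \<longrightarrow>
    C * e\<^sup>2 \<le> hardy_c DIM('a) ^ DIM('a) \<longrightarrow>
    (\<integral>\<^sup>+z. ennreal (\<bar>u z\<bar> ^ DIM('a) * (W z * remainder_weight DIM('a) C e (G z))) \<partial>lebesgue_on Om)
      \<le> (\<integral>\<^sup>+z. ennreal (norm (g z) ^ DIM('a)) \<partial>lebesgue_on Om)"
proof -
  obtain C where C: "0 \<le> C" "\<And>e t. 0 \<le> e \<Longrightarrow> e \<le> 1 \<Longrightarrow> 0 < t \<Longrightarrow>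
    remainder_weight DIM('a) C e t / t ^ DIM('a)
    \<le> - profile' DIM('a) e t - (real DIM('a) - 1) * (hardy_c DIM('a) * pert e t / t) ^ DIM('a)"
    using profile_gain[OF dim2] unfolding remainder_weight_def by blast
  show ?thesis
  proof (intro exI[of _ C] conjI C(1) allI impI)
    fix u :: "'a \<Rightarrow> real" and g e
    assume H: "hom_sobolev0 Om (real DIM('a)) u g" and e: "0 \<le> e" "e \<le> 1" "C * e\<^sup>2 \<le> hardy_c DIM('a) ^ DIM('a)"
    have pos: "0 \<le> remainder_weight DIM('a) C e t" if "0 < t" for t
      using e hardy_c[OF dim2] dim2 that by (auto simp: remainder_weight_def gain_def)
    have m: "(\<lambda>z. W z * remainder_weight DIM('a) C e (G z)) \<in> borel_measurable borel"
      unfolding remainder_weight_def gain_def by measurable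
    show "(\<integral>\<^sup>+z. ennreal (\<bar>u z\<bar> ^ DIM('a) * (W z * remainder_weight DIM('a) C e (G z))) \<partial>lebesgue_on Om)
      \<le> (\<integral>\<^sup>+z. ennreal (norm (g z) ^ DIM('a)) \<partial>lebesgue_on Om)"
      using hardy_test_function[OF _ e(1,2) C(2)[OF e(1,2)] pos] dim2
      by (intro hom_sobolev0_weighted_inequality[OF H _ open_Om m]) (auto simp: mult.assoc)
  qed
qed

theorem hardy_sobolev:
  assumes H: "hom_sobolev0 Om (real DIM('a)) u g"
  shows "ennreal (hardy_c DIM('a) ^ DIM('a)) * (\<integral>\<^sup>+z. ennreal (\<bar>u z\<bar> ^ DIM('a) * W z) \<partial>lebesgue_on Om)
      \<le> (\<integral>\<^sup>+z. ennreal (norm (g z) ^ DIM('a)) \<partial>lebesgue_on Om)"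
proof -
  obtain C where "(\<integral>\<^sup>+z. ennreal (\<bar>u z\<bar> ^ DIM('a) * (W z * remainder_weight DIM('a) C 0 (G z))) \<partial>lebesgue_on Om)
      \<le> (\<integral>\<^sup>+z. ennreal (norm (g z) ^ DIM('a)) \<partial>lebesgue_on Om)"
  proof -
    obtain C where C: "\<forall>u g e. hom_sobolev0 Om (real DIM('a)) u g \<longrightarrow> 0 \<le> e \<longrightarrow> e \<le> 1 \<longrightarrow>
        C * e\<^sup>2 \<le> hardy_c DIM('a) ^ DIM('a) \<longrightarrow>
      (\<integral>\<^sup>+z. ennreal (\<bar>u z\<bar> ^ DIM('a) * (W z * remainder_weight DIM('a) C e (G z))) \<partial>lebesgue_on Om)
      \<le> (\<integral>\<^sup>+z. ennreal (norm (g z) ^ DIM('a)) \<partial>lebesgue_on Om)"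
      using hardy_sobolev_remainder by blast
    show thesis using C[rule_format, OF H, of 0] hardy_c[OF dim2] by (intro that[of C]) simp
  qed
  moreover have "(\<lambda>z. ennreal (\<bar>u z\<bar> ^ DIM('a) * W z)) \<in> borel_measurable (lebesgue_on Om)"
  proof -
    have [measurable]: "u \<in> borel_measurable (lebesgue_on Om)" using H by (auto simp: hom_sobolev0_def)
    have [measurable]: "W \<in> borel_measurable (lebesgue_on Om)" by (intro borel_measurable_lebesgue_on) measurable
    show ?thesis by measurable
  qed
  moreover have "ennreal (\<bar>u z\<bar> ^ DIM('a) * (W z * remainder_weight DIM('a) C 0 (G z)))
    = ennreal (hardy_c DIM('a) ^ DIM('a)) * ennreal (\<bar>u z\<bar> ^ DIM('a) * W z)" for z
    using hardy_c[OF dim2] by (simp add: remainder_weight_def mult_ac flip: ennreal_mult')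
  ultimately show ?thesis by (simp add: nn_integral_cmult)
qed

text \<open>Let B' and D be the integrals of h = |u|^N W and of h times the gain. Under equality the
  remainder inequality becomes a D <= C B' e, so e to 0 gives D = 0; the gain and \<open>W\<close>
  are positive off the pole, hence u = 0.\<close>

theorem hardy_sobolev_not_attained:
  assumes H: "hom_sobolev0 Om (real DIM('a)) u g"
    and eq: "ennreal (hardy_c DIM('a) ^ DIM('a)) * (\<integral>\<^sup>+z. ennreal (\<bar>u z\<bar> ^ DIM('a) * W z) \<partial>lebesgue_on Om)
      = (\<integral>\<^sup>+z. ennreal (norm (g z) ^ DIM('a)) \<partial>lebesgue_on Om)"
  shows "AE z in lebesgue_on Om. u z = 0"
proof -
  let ?n = "DIM('a)" and ?M = "lebesgue_on Om" and ?c = "hardy_c DIM('a)"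
  have c: "0 < ?c" using hardy_c[OF dim2] by simp
  have [measurable]: "u \<in> borel_measurable ?M" using H by (auto simp: hom_sobolev0_def)
  have [measurable]: "W \<in> borel_measurable ?M" "G \<in> borel_measurable ?M"
    by (intro borel_measurable_lebesgue_on measurable_gr_G)+
  define h where "h z = \<bar>u z\<bar> ^ ?n * W z" for z
  have [measurable]: "h \<in> borel_measurable ?M" unfolding h_def[abs_def] by measurable
  have space: "z \<in> Om" if "z \<in> space ?M" for z using that by (simp add: space_restrict_space)
  have h0: "0 \<le> h z" if "z \<in> Om" for z using W_nonneg[OF that] by (simp add: h_def)
  have gain: "0 \<le> gain (G z)" "gain (G z) \<le> 1" if "z \<in> Om" for z
  proof -
    have "0 \<le> G z" using G_pos[OF that] by (cases "z = p") (auto simp: G_def)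
    then show "0 \<le> gain (G z)" "gain (G z) \<le> 1"
      by (auto simp: gain_def divide_le_eq power2_eq_square algebra_simps)
  qed
  \<comment> \<open>Finiteness of the gradient integral, hence of both sides of the equality, allows
    the main terms to be subtracted as real numbers.\<close>
  have A: "(\<integral>\<^sup>+z. ennreal (norm (g z) ^ ?n) \<partial>?M) < top"
    using hom_sobolev0_gradient_finite[OF H _ open_Om] by simp
  then have B: "(\<integral>\<^sup>+z. ennreal (h z) \<partial>?M) < top"
    using c unfolding eq[symmetric] h_def by (auto simp: ennreal_mult_less_top)
  have ih: "integrable ?M h"
    using B h0 space by (intro integrableI_nonneg) (auto intro!: AE_I2)
  have ik: "integrable ?M (\<lambda>z. h z * gain (G z))"
  proof (rule Bochner_Integration.integrable_bound[OF ih])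
    show "(\<lambda>z. h z * gain (G z)) \<in> borel_measurable ?M" unfolding gain_def by measurable
    show "AE z in ?M. norm (h z * gain (G z)) \<le> norm (h z)"
      using gain space by (intro AE_I2) (auto simp: abs_mult intro!: mult_left_le)
  qed
  define B' where "B' = (\<integral>z. h z \<partial>?M)"
  define D where "D = (\<integral>z. h z * gain (G z) \<partial>?M)"
  have B'0: "0 \<le> B'" unfolding B'_def using h0 space by (intro integral_nonneg_AE AE_I2) auto
  have D0: "0 \<le> D" unfolding D_def using h0 gain space by (intro integral_nonneg_AE AE_I2) auto
  have Aeq: "(\<integral>\<^sup>+z. ennreal (norm (g z) ^ ?n) \<partial>?M) = ennreal (?c ^ ?n * B')"
  proof -
    have "(\<integral>\<^sup>+z. ennreal (h z) \<partial>?M) = ennreal B'"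
      unfolding B'_def using h0 space by (intro nn_integral_eq_integral[OF ih] AE_I2) auto
    then show ?thesis using c B'0 unfolding eq[symmetric] h_def by (simp add: ennreal_mult)
  qed
  have "\<exists>C\<ge>0. \<forall>e. 0 \<le> e \<longrightarrow> e \<le> 1 \<longrightarrow> C * e\<^sup>2 \<le> ?c ^ ?n \<longrightarrow>
    (\<integral>\<^sup>+z. ennreal (\<bar>u z\<bar> ^ ?n * (W z * remainder_weight ?n C e (G z))) \<partial>?M)
      \<le> (\<integral>\<^sup>+z. ennreal (norm (g z) ^ ?n) \<partial>?M)"
    using hardy_sobolev_remainder H by fast
  then obtain C where C: "0 \<le> C" "\<And>e. 0 \<le> e \<Longrightarrow> e \<le> 1 \<Longrightarrow> C * e\<^sup>2 \<le> ?c ^ ?n \<Longrightarrow>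
    (\<integral>\<^sup>+z. ennreal (\<bar>u z\<bar> ^ ?n * (W z * remainder_weight ?n C e (G z))) \<partial>?M)
      \<le> (\<integral>\<^sup>+z. ennreal (norm (g z) ^ ?n) \<partial>?M)"
    by blast
  define a where "a = (real ?n - 1) * ?c ^ (?n - 1)"
  have a: "0 < a" using c dim2 by (simp add: a_def)
  have key: "a * D \<le> C * B' * e" if e: "0 < e" "e \<le> 1" "C * e\<^sup>2 \<le> ?c ^ ?n" for e
  proof -
    let ?w = "\<lambda>z. (?c ^ ?n - C * e\<^sup>2) * h z + a * e * (h z * gain (G z))"
    have w: "\<bar>u z\<bar> ^ ?n * (W z * remainder_weight ?n C e (G z)) = ?w z" for z
      by (simp add: remainder_weight_def h_def a_def algebra_simps)
    have "ennreal (\<integral>z. ?w z \<partial>?M) = (\<integral>\<^sup>+z. ennreal (?w z) \<partial>?M)"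
    proof (rule nn_integral_eq_integral[symmetric])
      show "integrable ?M ?w"
        using ih ik by (intro Bochner_Integration.integrable_add integrable_mult_right) auto
      show "AE z in ?M. 0 \<le> ?w z"
        using e a h0 gain space by (intro AE_I2 add_nonneg_nonneg mult_nonneg_nonneg) auto
    qed
    also have "\<dots> \<le> ennreal (?c ^ ?n * B')"
      using C(2)[of e] e unfolding w Aeq by simp
    finally have "(\<integral>z. ?w z \<partial>?M) \<le> ?c ^ ?n * B'"
      using c B'0 by (subst (asm) ennreal_le_iff) auto
    moreover have "(\<integral>z. ?w z \<partial>?M) = (?c ^ ?n - C * e\<^sup>2) * B' + a * e * D"
      unfolding B'_def D_def using ih ik by (subst Bochner_Integration.integral_add) auto
    ultimately have "e * (a * D) \<le> e * (C * B' * e)"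
      by (simp add: algebra_simps power2_eq_square)
    then show ?thesis using e by simp
  qed
  have "D = 0"
  proof -
    \<comment> \<open>Chosen so that every e in (0, e0] satisfies
      \<open>C * e\<^sup>2 \<le> ?c ^ ?n\<close>; the summand 1 avoids division by zero when
      \<open>C\<close> is 0.\<close>
    define e0 where "e0 = min 1 (?c ^ ?n / (C + 1))"
    have e0: "0 < e0" "e0 \<le> 1"
      using c C(1) by (auto simp: e0_def)
    have "e0 \<le> ?c ^ ?n / (C + 1)" by (simp add: e0_def)
    then have e0': "(C + 1) * e0 \<le> ?c ^ ?n"
      using C(1) by (simp add: pos_le_divide_eq mult.commute)
    have "a * D \<le> C * B' * (e0 * inverse (real (Suc k)))" for k
    proof (rule key)
      show "0 < e0 * inverse (real (Suc k))" using e0 by simp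
      have *: "e0 * inverse (real (Suc k)) \<le> e0 * 1"
        using e0 by (intro mult_left_mono) (auto simp: inverse_le_1_iff)
      then show 1: "e0 * inverse (real (Suc k)) \<le> 1" using e0(2) by linarith
      have "C * (e0 * inverse (real (Suc k)))\<^sup>2 \<le> C * (1 * e0)"
        unfolding power2_eq_square using 1 * e0 C(1) by (intro mult_left_mono mult_mono) auto
      also have "\<dots> \<le> (C + 1) * e0" using e0 by (simp add: algebra_simps)
      finally show "C * (e0 * inverse (real (Suc k)))\<^sup>2 \<le> ?c ^ ?n" using e0' by simp
    qed
    moreover have "(\<lambda>k. C * B' * (e0 * inverse (real (Suc k)))) \<longlonglongrightarrow> C * B' * (e0 * 0)"
      by (intro tendsto_intros LIMSEQ_inverse_real_of_nat)
    ultimately have "a * D \<le> C * B' * (e0 * 0)"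
      by (intro LIMSEQ_le_const) auto
    then show ?thesis using a D0 by (simp add: mult_le_0_iff)
  qed
  then have "AE z in ?M. h z * gain (G z) = 0"
    unfolding D_def using h0 gain space
    by (subst (asm) integral_nonneg_eq_0_iff_AE[OF ik]) (auto intro!: AE_I2)
  \<comment> \<open>At the pole the default value \<open>W p = 0\<close> gives no information about
    \<open>u\<close>, so this null set is removed.\<close>
  moreover have "AE z in ?M. z \<noteq> p"
    using open_Om AE_completion[OF AE_lborel_singleton[of p]]
    by (subst AE_restrict_space_iff) (auto elim: eventually_mono)
  moreover have "AE z in ?M. z \<in> Om"
    using space by (intro AE_I2)
  ultimately show ?thesis
  proof eventually_elim
    case (elim z)
    then have "z \<noteq> q" "0 < G z" using q_notin_Om G_pos by auto
    then have "0 < W z" "0 < gain (G z)"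
      using elim gr_pos[of z] by (auto simp: W_def gain_def)
    then show ?case using elim by (simp add: h_def)
  qed
qed

end

section \<open>Smooth functions on open sets\<close>

text \<open>A local form of \<open>Ck\<close>, since \<open>ln (G z)\<close> is smooth only off the
  poles. The derivative is existentially quantified, so closure properties follow by exhibiting
  one.\<close>

primrec Ck_on :: "nat \<Rightarrow> 'a::euclidean_space set \<Rightarrow> ('a \<Rightarrow> real) \<Rightarrow> bool" where
  "Ck_on 0 = continuous_on"
| "Ck_on (Suc k) = (\<lambda>U f. \<exists>f'. (\<forall>z\<in>U. (f has_derivative f' z) (at z)) \<and>
     (\<forall>b\<in>Basis. Ck_on k U (\<lambda>z. f' z b)))"

declare Ck_on.simps(2) [simp del]

lemma Ck_on_SucI:
  "(\<And>z. z \<in> U \<Longrightarrow> (f has_derivative f' z) (at z)) \<Longrightarrow>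
    (\<And>b. b \<in> Basis \<Longrightarrow> Ck_on k U (\<lambda>z. f' z b)) \<Longrightarrow> Ck_on (Suc k) U f"
  by (auto simp: Ck_on.simps(2))

lemma Ck_on_SucE:
  assumes "Ck_on (Suc k) U f"
  obtains f' where "\<forall>z\<in>U. (f has_derivative f' z) (at z)" "\<forall>b\<in>Basis. Ck_on k U (\<lambda>z. f' z b)"
  using assms by (auto simp: Ck_on.simps(2))

lemma Ck_on_continuous: "Ck_on k U f \<Longrightarrow> continuous_on U f"
  by (cases k) (auto intro!: continuous_at_imp_continuous_on dest: has_derivative_continuous elim!: Ck_on_SucE)

lemma Ck_on_SucD: "Ck_on (Suc k) U f \<Longrightarrow> Ck_on k U f"
proof (induction k arbitrary: f)
  case 0
  from Ck_on_continuous[OF this] show ?case by simp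
next
  case (Suc k)
  from Suc.prems(1) obtain f' where "\<forall>z\<in>U. (f has_derivative f' z) (at z)"
    "\<forall>b\<in>Basis. Ck_on (Suc k) U (\<lambda>z. f' z b)" by (rule Ck_on_SucE)
  then show ?case using Suc.IH by (intro Ck_on_SucI[of _ _ f']) auto
qed

lemma Ck_on_subset: "Ck_on k U f \<Longrightarrow> V \<subseteq> U \<Longrightarrow> Ck_on k V f"
proof (induction k arbitrary: f)
  case (Suc k)
  from Suc.prems(1) obtain f' where "\<forall>z\<in>U. (f has_derivative f' z) (at z)"
    "\<forall>b\<in>Basis. Ck_on k U (\<lambda>z. f' z b)" by (rule Ck_on_SucE)
  then show ?case using Suc.IH Suc.prems(2) by (intro Ck_on_SucI[of _ _ f']) auto
qed (auto intro: continuous_on_subset)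

lemma Ck_on_cong:
  assumes "open U" "\<And>z. z \<in> U \<Longrightarrow> f z = g z" "Ck_on k U f"
  shows "Ck_on k U g"
proof (cases k)
  case 0
  then show ?thesis using assms continuous_on_cong[of U U f g] by simp
next
  case (Suc j)
  obtain f' where f': "\<forall>z\<in>U. (f has_derivative f' z) (at z)"
    "\<forall>b\<in>Basis. Ck_on j U (\<lambda>z. f' z b)" by (rule Ck_on_SucE[OF assms(3)[unfolded Suc]])
  have "(g has_derivative f' z) (at z)" if "z \<in> U" for z
    using has_derivative_transform_within_open[OF _ assms(1) that assms(2)] f' that by auto
  then show ?thesis using f' unfolding Suc by (intro Ck_on_SucI[of _ _ f']) auto
qed

lemma Ck_on_const: "Ck_on k U (\<lambda>_. c)"
proof (induction k arbitrary: c)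
  case (Suc k)
  show ?case by (rule Ck_on_SucI[of _ _ "\<lambda>_ _. 0"]) (auto intro: Suc)
qed simp

lemma Ck_on_inner: "Ck_on k U (\<lambda>z. z \<bullet> a)"
proof (cases k)
  case (Suc j)
  have "((\<lambda>z. z \<bullet> a) has_derivative (\<lambda>v. v \<bullet> a)) (at z)" for z
    by (auto intro!: derivative_eq_intros)
  then show ?thesis unfolding Suc by (intro Ck_on_SucI[of _ _ "\<lambda>_ v. v \<bullet> a"] Ck_on_const)
qed (auto intro!: continuous_intros)

lemma Ck_on_add: "Ck_on k U f \<Longrightarrow> Ck_on k U g \<Longrightarrow> Ck_on k U (\<lambda>z. f z + g z)"
proof (induction k arbitrary: f g)
  case (Suc k)
  obtain f' where f': "\<forall>z\<in>U. (f has_derivative f' z) (at z)"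
    "\<forall>b\<in>Basis. Ck_on k U (\<lambda>z. f' z b)" by (rule Ck_on_SucE[OF Suc.prems(1)])
  obtain g' where g': "\<forall>z\<in>U. (g has_derivative g' z) (at z)"
    "\<forall>b\<in>Basis. Ck_on k U (\<lambda>z. g' z b)" by (rule Ck_on_SucE[OF Suc.prems(2)])
  show ?case
    using f' g' Suc.IH by (intro Ck_on_SucI[of _ _ "\<lambda>z v. f' z v + g' z v"]) (auto intro!: has_derivative_add)
qed (auto intro!: continuous_intros)

lemma Ck_on_mult: "Ck_on k U f \<Longrightarrow> Ck_on k U g \<Longrightarrow> Ck_on k U (\<lambda>z. f z * g z)"
proof (induction k arbitrary: f g)
  case (Suc k)
  obtain f' where f': "\<forall>z\<in>U. (f has_derivative f' z) (at z)"
    "\<forall>b\<in>Basis. Ck_on k U (\<lambda>z. f' z b)" by (rule Ck_on_SucE[OF Suc.prems(1)])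
  obtain g' where g': "\<forall>z\<in>U. (g has_derivative g' z) (at z)"
    "\<forall>b\<in>Basis. Ck_on k U (\<lambda>z. g' z b)" by (rule Ck_on_SucE[OF Suc.prems(2)])
  show ?case
    using f' g' Suc.IH Suc.prems[THEN Ck_on_SucD]
    by (intro Ck_on_SucI[of _ _ "\<lambda>z v. f z * g' z v + f' z v * g z"]) (auto intro!: has_derivative_mult Ck_on_add)
qed (auto intro!: continuous_intros)

text \<open>The outer function has one real variable, so the chain rule yields a product of two
  scalar functions and the induction closes with \<open>Ck_on_mult\<close>.\<close>

lemma Ck_on_compose:
  fixes g :: "real \<Rightarrow> real"
  shows "Ck_on k T g \<Longrightarrow> Ck_on k U f \<Longrightarrow> f ` U \<subseteq> T \<Longrightarrow> Ck_on k U (\<lambda>z. g (f z))"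
proof (induction k arbitrary: g)
  case 0
  then show ?case by (auto intro: continuous_on_compose2)
next
  case (Suc k)
  obtain f' where f': "\<forall>z\<in>U. (f has_derivative f' z) (at z)"
    "\<forall>b\<in>Basis. Ck_on k U (\<lambda>z. f' z b)" by (rule Ck_on_SucE[OF Suc.prems(2)])
  obtain g' where g': "\<forall>x\<in>T. (g has_derivative g' x) (at x)"
    "Ck_on k T (\<lambda>x. g' x 1)" using Suc.prems(1) by (auto elim!: Ck_on_SucE)
  have "((\<lambda>z. g (f z)) has_derivative (\<lambda>v. f' z v * g' (f z) 1)) (at z)" if z: "z \<in> U" for z
  proof -
    have "f z \<in> T" using z Suc.prems by auto
    then have d: "(g has_derivative g' (f z)) (at (f z))" using g' by auto
    then have "linear (g' (f z))" using has_derivative_linear by blast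
    then have "g' (f z) s = s * g' (f z) 1" for s
      using linear_scale[of "g' (f z)" s 1] by simp
    then have "(\<lambda>v. g' (f z) (f' z v)) = (\<lambda>v. f' z v * g' (f z) 1)" by (rule ext)
    then show ?thesis
      by (rule has_derivative_eq_rhs[OF has_derivative_compose[OF f'(1)[rule_format, OF z] d]])
  qed
  then show ?case
    using f' Suc.IH[OF g'(2) Ck_on_SucD[OF Suc.prems(2)] Suc.prems(3)]
    by (intro Ck_on_SucI[of _ _ "\<lambda>z v. f' z v * g' (f z) 1"]) (auto intro!: Ck_on_mult)
qed

lemma Ck_on_real_derivI:
  fixes f :: "real \<Rightarrow> real"
  assumes "\<And>x. x \<in> U \<Longrightarrow> (f has_real_derivative f' x) (at x)" "Ck_on k U f'"
  shows "Ck_on (Suc k) U f"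
  using assms by (intro Ck_on_SucI[of _ _ "\<lambda>x v. f' x * v"]) (auto simp: has_field_derivative_def)

lemma Ck_on_inverse: "Ck_on k (- {0}) (inverse :: real \<Rightarrow> real)"
proof (induction k)
  case (Suc k)
  show ?case
  proof (rule Ck_on_real_derivI)
    show "Ck_on k (- {0}) (\<lambda>x::real. (- 1) * (inverse x * inverse x))"
      by (intro Ck_on_mult Ck_on_const Suc)
  qed (auto intro!: derivative_eq_intros)
qed (auto intro!: continuous_intros)

lemma Ck_on_ln: "Ck_on k {0<..} (ln :: real \<Rightarrow> real)"
proof (cases k)
  case (Suc j)
  show ?thesis unfolding Suc
  proof (rule Ck_on_real_derivI)
    show "Ck_on j {0<..} (inverse :: real \<Rightarrow> real)"
      by (rule Ck_on_subset[OF Ck_on_inverse]) auto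
  qed (auto intro!: derivative_eq_intros simp: inverse_eq_divide)
qed (auto intro!: continuous_intros)

lemma Ck_on_exp: "Ck_on k U (exp :: real \<Rightarrow> real)"
proof (induction k)
  case (Suc k)
  then show ?case by (rule Ck_on_real_derivI[rotated]) (auto intro!: derivative_eq_intros)
qed (auto intro!: continuous_intros)

text \<open>Gluing for trial functions, which are given by a formula on one open set and by zero on
  another. Derivatives agree on the overlap by uniqueness.\<close>

lemma Ck_on_Un:
  assumes "open U" "open V"
  shows "Ck_on k U f \<Longrightarrow> Ck_on k V f \<Longrightarrow> Ck_on k (U \<union> V) f"
proof (induction k arbitrary: f)
  case 0
  then show ?case using assms by (auto intro: continuous_on_open_Un)
next
  case (Suc k)
  obtain f1 where f1: "\<forall>z\<in>U. (f has_derivative f1 z) (at z)"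
    "\<forall>b\<in>Basis. Ck_on k U (\<lambda>z. f1 z b)" by (rule Ck_on_SucE[OF Suc.prems(1)])
  obtain f2 where f2: "\<forall>z\<in>V. (f has_derivative f2 z) (at z)"
    "\<forall>b\<in>Basis. Ck_on k V (\<lambda>z. f2 z b)" by (rule Ck_on_SucE[OF Suc.prems(2)])
  define f' where "f' z = (if z \<in> U then f1 z else f2 z)" for z
  have V: "f2 z = f' z" if "z \<in> V" for z
  proof (cases "z \<in> U")
    case True
    then show ?thesis using has_derivative_unique[of f "f2 z" z "f1 z"] f1(1) f2(1) that by (simp add: f'_def)
  qed (simp add: f'_def)
  have "Ck_on k U (\<lambda>z. f' z b)" "Ck_on k V (\<lambda>z. f' z b)" if "b \<in> Basis" for b
  proof -
    show "Ck_on k U (\<lambda>z. f' z b)"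
      by (rule Ck_on_cong[OF assms(1) _ f1(2)[rule_format, OF that]]) (simp add: f'_def)
    show "Ck_on k V (\<lambda>z. f' z b)"
      by (rule Ck_on_cong[OF assms(2) _ f2(2)[rule_format, OF that]]) (simp only: V)
  qed
  moreover have "\<forall>z\<in>U \<union> V. (f has_derivative f' z) (at z)"
    using f1(1) f2(1) by (auto simp: f'_def)
  ultimately show ?case using Suc.IH by (intro Ck_on_SucI[of _ _ f']) auto
qed

lemma Ck_on_imp_Ck: "Ck_on k UNIV f \<Longrightarrow> Ck k f"
proof (induction k arbitrary: f)
  case (Suc k)
  obtain f' where f': "\<forall>z\<in>UNIV. (f has_derivative f' z) (at z)"
    "\<forall>b\<in>Basis. Ck_on k UNIV (\<lambda>z. f' z b)" by (rule Ck_on_SucE[OF Suc.prems])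
  then have "frechet_derivative f (at z) = f' z" for z
    using frechet_derivative_at[of f "f' z" z] f'(1) by simp
  then show ?case using f' Suc.IH by (auto simp: differentiable_def)
qed simp

section \<open>A smooth bump function\<close>

definition flat :: "nat \<Rightarrow> real \<Rightarrow> real" where
  "flat m x = (if 0 < x then inverse x ^ m * exp (- inverse x) else 0)"

text \<open>The family containing exp(-1/x) is closed under differentiation up to linear
  combinations, which gives smoothness by induction. At 0 the difference quotient of
  \<open>flat m\<close> is \<open>flat (m + 1)\<close>, and the exponential beats every
  power.\<close>

lemma flat_derivative:
  "(flat m has_real_derivative flat (m + 2) x - real m * flat (m + 1) x) (at x)"
proof -
  consider "x > 0" | "x < 0" | "x = 0" by linarith
  then show ?thesis
  proof cases
    case 1
    have "((\<lambda>x. inverse x ^ m * exp (- inverse x)) has_real_derivative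
        flat (m + 2) x - real m * flat (m + 1) x) (at x)"
    proof -
      have d: "(inverse has_real_derivative - (inverse x ^ Suc (Suc 0))) (at x)"
        using 1 by (intro DERIV_inverse) simp
      have e: "((\<lambda>x. exp (- inverse x)) has_real_derivative
          exp (- inverse x) * - (- (inverse x ^ Suc (Suc 0)))) (at x)"
        by (rule DERIV_chain2[OF DERIV_exp DERIV_minus[OF d]])
      \<comment> \<open>Reconciles the truncated exponent m - 1 of the power rule with the stated
        formula, including m = 0.\<close>
      have m: "real m * (r\<^sup>2 * r ^ (m - Suc 0)) = real m * (r * r ^ m)" for r
        by (cases m) (auto simp: power2_eq_square)
      show ?thesis
        by (rule DERIV_cong[OF DERIV_mult[OF DERIV_power[OF d, of m] e]])
          (use 1 m[of "inverse x"] in \<open>auto simp: flat_def algebra_simps power2_eq_square\<close>)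
    qed
    then show ?thesis
      by (rule has_field_derivative_transform_within_open[of _ _ _ "{0<..}"]) (use 1 in \<open>auto simp: flat_def\<close>)
  next
    case 2
    show ?thesis
      by (rule has_field_derivative_transform_within_open[of "\<lambda>_. 0" _ _ "{..<0}"]) (use 2 in \<open>auto simp: flat_def\<close>)
  next
    case 3
    have "((\<lambda>y. y ^ (m + 1) / exp y) \<longlongrightarrow> 0) (at_top :: real filter)"
      by (rule tendsto_power_div_exp_0)
    then have r: "((\<lambda>x. inverse x ^ (m + 1) / exp (inverse x)) \<longlongrightarrow> 0) (at_right (0::real))"
      by (rule filterlim_compose[OF _ filterlim_inverse_at_top_right])
    have "((\<lambda>x. flat (m + 1) x) \<longlongrightarrow> 0) (at_right 0)"
      by (rule tendsto_cong[THEN iffD1, OF _ r])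
        (auto simp: flat_def exp_minus divide_inverse eventually_at_filter)
    moreover have "((\<lambda>x. flat (m + 1) x) \<longlongrightarrow> 0) (at_left 0)"
      by (rule tendsto_eventually) (auto simp: flat_def eventually_at_filter)
    ultimately have "((\<lambda>x. flat (m + 1) x) \<longlongrightarrow> 0) (at 0)"
      by (simp add: filterlim_at_split)
    moreover have "flat m h / h = flat (m + 1) h" for h
      by (simp add: flat_def divide_inverse)
    ultimately show ?thesis using 3 by (simp add: DERIV_def flat_def)
  qed
qed

lemma Ck_on_flat: "Ck_on k UNIV (flat m)"
proof (induction k arbitrary: m)
  case 0
  show ?case using flat_derivative by (auto intro!: continuous_at_imp_continuous_on DERIV_isCont)
next
  case (Suc k)
  have "Ck_on k UNIV (\<lambda>x. flat (m + 2) x + - real m * flat (m + 1) x)"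
    by (intro Ck_on_add Ck_on_mult Ck_on_const Suc)
  then show ?case
    by (intro Ck_on_real_derivI[where f' = "\<lambda>x. flat (m + 2) x - real m * flat (m + 1) x"] flat_derivative) simp
qed

definition bump :: "real \<Rightarrow> real" where "bump s = flat 0 (1 - s) * flat 0 (1 + s)"

definition bump' :: "real \<Rightarrow> real" where
  "bump' s = flat 0 (1 - s) * flat 2 (1 + s) - flat 2 (1 - s) * flat 0 (1 + s)"

lemma bump_derivative: "(bump has_real_derivative bump' s) (at s)"
proof -
  have 0: "(flat 0 has_real_derivative flat 2 x) (at x)" for x
    using flat_derivative[of 0 x] by (simp add: numeral_2_eq_2)
  have 1: "((\<lambda>s. flat 0 (1 - s)) has_real_derivative flat 2 (1 - s) * (0 - 1)) (at s)"
    by (rule DERIV_chain2[OF 0 DERIV_diff[OF DERIV_const DERIV_ident]])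
  have 2: "((\<lambda>s. flat 0 (1 + s)) has_real_derivative flat 2 (1 + s) * (0 + 1)) (at s)"
    by (rule DERIV_chain2[OF 0 DERIV_add[OF DERIV_const DERIV_ident]])
  show ?thesis unfolding bump_def[abs_def] bump'_def
    using DERIV_mult[OF 1 2] by (simp add: mult.commute)
qed

lemma Ck_on_bump: "Ck_on k UNIV bump"
proof -
  have id: "Ck_on k UNIV (\<lambda>s::real. s)" using Ck_on_inner[of k UNIV "1::real"] by simp
  have "Ck_on k UNIV (\<lambda>s::real. 1 + - 1 * s)" "Ck_on k UNIV (\<lambda>s::real. 1 + s)"
    by (intro Ck_on_add Ck_on_mult Ck_on_const id)+
  then show ?thesis unfolding bump_def[abs_def]
    by (intro Ck_on_mult Ck_on_compose[OF Ck_on_flat]) simp_all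
qed

lemma bump_continuous: "continuous_on S bump" "continuous_on S bump'"
proof -
  show "continuous_on S bump" using continuous_on_subset[OF Ck_on_continuous[OF Ck_on_bump]] by simp
  have f: "continuous_on S (\<lambda>s. flat m (f s))" if "continuous_on S f" for m f
    using continuous_on_compose2[OF Ck_on_continuous[OF Ck_on_flat] that] by simp
  have "continuous_on S (\<lambda>s. flat m (1 - s))" "continuous_on S (\<lambda>s. flat m (1 + s))" for m
    by (intro f continuous_on_diff continuous_on_add continuous_on_const continuous_on_id)+
  then show "continuous_on S bump'" unfolding bump'_def
    by (intro continuous_on_diff continuous_on_mult)
qed

lemma bump_outside: "1 \<le> \<bar>s\<bar> \<Longrightarrow> bump s = 0" "1 \<le> \<bar>s\<bar> \<Longrightarrow> bump' s = 0"
  by (auto simp: bump_def bump'_def flat_def)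

lemma bump_nonneg: "0 \<le> bump s" and bump_pos: "\<bar>s\<bar> < 1 \<Longrightarrow> 0 < bump s"
  by (auto simp: bump_def flat_def)

section \<open>Sharpness of the constant\<close>

text \<open>The primitive normalized at -1 is constant on each side of the support; zero mean makes
  both constants 0.\<close>

lemma compactly_supported_primitive:
  fixes \<kappa> :: "real \<Rightarrow> real"
  assumes cont: "continuous_on UNIV \<kappa>" and supp: "\<And>s. 1 \<le> \<bar>s\<bar> \<Longrightarrow> \<kappa> s = 0"
    and int: "integral {-1..1} \<kappa> = 0"
  obtains P where "\<And>s. (P has_real_derivative \<kappa> s) (at s)" "\<And>s. 1 \<le> \<bar>s\<bar> \<Longrightarrow> P s = 0"
proof -
  have "\<forall>x. -\<infinity> < ereal x \<longrightarrow> ereal x < \<infinity> \<longrightarrow> isCont \<kappa> x"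
    using cont by (simp add: continuous_on_eq_continuous_at)
  then obtain F where "\<forall>x::real. -\<infinity> < ereal x \<longrightarrow> ereal x < \<infinity> \<longrightarrow> (F has_vector_derivative \<kappa> x) (at x)"
    using einterval_antiderivative[of "-\<infinity>" "\<infinity>" \<kappa>] by auto
  then have F: "(F has_real_derivative \<kappa> x) (at x)" for x
    by (simp add: has_real_derivative_iff_has_vector_derivative)
  define P where "P s = F s - F (-1)" for s
  have P: "(P has_real_derivative \<kappa> s) (at s)" for s
    unfolding P_def[abs_def] using DERIV_diff[OF F DERIV_const] by simp
  have cP: "continuous_on A P" for A
    using P by (auto intro!: continuous_at_imp_continuous_on DERIV_isCont)
  have "(\<kappa> has_integral (P 1 - P (-1))) {-1..1}"
    using P by (intro fundamental_theorem_of_calculus)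
      (auto simp: has_real_derivative_iff_has_vector_derivative[symmetric] intro: has_field_derivative_at_within)
  then have P1: "P 1 = 0" using int by (simp add: P_def has_integral_iff)
  have "P s = 0" if s: "1 \<le> \<bar>s\<bar>" for s
  proof -
    consider "s = 1" | "s = -1" | "1 < s" | "s < -1" using s by linarith
    then show ?thesis
    proof cases
      case 3
      have "(P has_real_derivative 0) (at x)" if "1 < x" for x
        using P[of x] supp[of x] that by simp
      then have "P s = P 1" by (intro DERIV_isconst_end[OF 3 cP])
      then show ?thesis using P1 by simp
    next
      case 4
      have "(P has_real_derivative 0) (at x)" if "x < -1" for x
        using P[of x] supp[of x] that by simp
      then have "P (-1) = P s" by (intro DERIV_isconst_end[OF 4 cP])
      then show ?thesis by (simp add: P_def)
    qed (use P1 in \<open>auto simp: P_def\<close>)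
  qed
  then show ?thesis using that P by blast
qed

section \<open>Integrals over shells between level sets of \<open>G\<close>, and the trial
  functions\<close>

context two_poles
begin

text \<open>For e > 0 this is the set |e ln G| <= 1 in \<open>Om - {p}\<close>. Clearing logarithms
  and quotients makes it visibly closed.\<close>

definition shell :: "real \<Rightarrow> 'a set" where
  "shell e = {z. exp (exp (- (1 / e))) * norm (z - p) \<le> norm (z - q) \<and>
     norm (z - q) \<le> exp (exp (1 / e)) * norm (z - p)}"

lemma shell_subset: "shell e \<subseteq> Om - {p}"
proof
  fix z assume z: "z \<in> shell e"
  then have "z \<noteq> p" using pq by (auto simp: shell_def)
  moreover have "1 * norm (z - p) < exp (exp (- (1 / e))) * norm (z - p)"
    using \<open>z \<noteq> p\<close> by (intro mult_strict_right_mono) auto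
  moreover have "exp (exp (- (1 / e))) * norm (z - p) \<le> norm (z - q)"
    using z by (simp add: shell_def)
  ultimately have "norm (z - p) < norm (z - q)" by linarith
  then show "z \<in> Om - {p}" using \<open>z \<noteq> p\<close> by (simp add: Om_def)
qed

text \<open>The lower inequality has factor a > 1, so the triangle inequality confines the shell to
  a ball about \<open>p\<close>.\<close>

lemma compact_shell: "compact (shell e)"
proof (rule compact_eq_bounded_closed[THEN iffD2], rule conjI)
  define a where "a = exp (exp (- (1 / e)))"
  have a: "1 < a" by (simp add: a_def)
  have "norm (z - p) \<le> norm (p - q) / (a - 1)" if "z \<in> shell e" for z
  proof -
    have "a * norm (z - p) \<le> norm (z - q)" using that by (simp add: shell_def a_def)
    also have "\<dots> \<le> norm (z - p) + norm (p - q)" using norm_triangle_ineq[of "z - p" "p - q"] by simp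
    finally show ?thesis using a by (simp add: field_simps)
  qed
  then have "shell e \<subseteq> cball p (norm (p - q) / (a - 1))" by (auto simp: dist_norm norm_minus_commute)
  then show "bounded (shell e)" using bounded_subset bounded_cball by blast
  show "closed (shell e)" unfolding shell_def
    by (intro closed_Collect_conj closed_Collect_le continuous_intros)
qed

lemma outside_shell:
  assumes "0 < e" "z \<in> Om - {p}" "z \<notin> shell e"
  shows "1 \<le> \<bar>e * ln (G z)\<bar>"
proof -
  have z: "0 < norm (z - p)" "0 < norm (z - q)" "0 < G z"
    using assms q_notin_Om G_pos by auto
  have G: "exp (G z) = norm (z - q) / norm (z - p)" using z by (simp add: G_def)
  have "exp (G z) < exp (exp (- (1 / e))) \<or> exp (exp (1 / e)) < exp (G z)"
    using assms(3) z by (auto simp: G shell_def field_simps not_le)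
  then have "G z < exp (- (1 / e)) \<or> exp (1 / e) < G z" by simp
  then have "ln (G z) < - (1 / e) \<or> 1 / e < ln (G z)"
  proof
    assume "G z < exp (- (1 / e))"
    then have "ln (G z) < ln (exp (- (1 / e)))" using z by (subst ln_less_cancel_iff) auto
    then show ?thesis by simp
  next
    assume "exp (1 / e) < G z"
    then have "ln (exp (1 / e)) < ln (G z)" using z by (subst ln_less_cancel_iff) auto
    then show ?thesis by simp
  qed
  then have "e * ln (G z) < - 1 \<or> 1 < e * ln (G z)"
    using assms(1) by (auto simp: field_simps)
  then show ?thesis by linarith
qed

lemma lnG_derivative:
  assumes "z \<in> Om - {p}"
  shows "((\<lambda>z. ln (G z)) has_derivative (\<lambda>v. (dG z \<bullet> v) / G z)) (at z)"
proof -
  have z: "z \<noteq> p" "z \<noteq> q" "0 < G z" using assms q_notin_Om G_pos by auto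
  show ?thesis
    using DERIV_compose_FDERIV[OF DERIV_ln[OF z(3)] G_derivative[OF z(1,2)]] by (simp add: divide_inverse)
qed

lemma lnG_continuous: "continuous_on (Om - {p}) (\<lambda>z. ln (G z))"
  using G_pos by (intro continuous_on_ln G_continuous) force

text \<open>By the coarea formula and constant flux through level sets this would be a constant
  multiple of the integral of \<kappa> divided by e. Only the proportionality is needed, and the
  divergence theorem provides it.\<close>

definition shell_integral :: "real \<Rightarrow> (real \<Rightarrow> real) \<Rightarrow> real" where
  "shell_integral e \<kappa> = (\<integral>z. indicator (shell e) z * (\<kappa> (e * ln (G z)) * gr z ^ DIM('a) / G z) \<partial>lborel)"

lemma shell_integrable:
  assumes "continuous_on UNIV \<kappa>"
  shows "integrable lborel (\<lambda>z. indicator (shell e) z * (\<kappa> (e * ln (G z)) * gr z ^ DIM('a) / G z))"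
proof -
  have "continuous_on (shell e) (\<lambda>z. \<kappa> (e * ln (G z)) * gr z ^ DIM('a) / G z)"
  proof (rule continuous_on_subset[OF _ shell_subset])
    have "continuous_on (Om - {p}) gr" unfolding gr_def[abs_def]
      using q_notin_Om by (auto intro!: continuous_intros)
    moreover have "continuous_on (Om - {p}) (\<lambda>z. \<kappa> (e * ln (G z)))"
      by (rule continuous_on_compose2[OF assms]) (auto intro!: continuous_intros lnG_continuous)
    ultimately show "continuous_on (Om - {p}) (\<lambda>z. \<kappa> (e * ln (G z)) * gr z ^ DIM('a) / G z)"
      using G_pos by (intro continuous_intros G_continuous) force+
  qed
  from borel_integrable_compact[OF compact_shell this] show ?thesis by simp
qed

lemma shell_integrand_nonneg:
  assumes "\<And>s. 0 \<le> \<kappa> s"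
  shows "0 \<le> indicator (shell e) z * (\<kappa> (e * ln (G z)) * gr z ^ DIM('a) / G z)"
proof (cases "z \<in> shell e")
  case True
  then have "0 < G z" using G_pos[of z] shell_subset[of e] by auto
  moreover have "0 \<le> gr z" by (simp add: gr_def)
  ultimately show ?thesis using True assms by simp
qed simp

text \<open>If P is the compactly supported primitive of \<kappa>, the integrand times e is the
  divergence of P(e ln G) \<open>Y\<close>.\<close>

lemma shell_integral_eq_0:
  assumes e: "0 < e" and cont: "continuous_on UNIV \<kappa>" and supp: "\<And>s. 1 \<le> \<bar>s\<bar> \<Longrightarrow> \<kappa> s = 0"
    and int: "integral {-1..1} \<kappa> = 0"
  shows "shell_integral e \<kappa> = 0"
proof -
  obtain P where P: "\<And>s. (P has_real_derivative \<kappa> s) (at s)" "\<And>s. 1 \<le> \<bar>s\<bar> \<Longrightarrow> P s = 0"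
    using compactly_supported_primitive[OF cont supp int] by blast
  let ?U = "Om - {p}"
  define \<zeta> where "\<zeta> z = (if z \<in> ?U then P (e * ln (G z)) else 0)" for z
  define \<zeta>' where "\<zeta>' z v = e * (\<kappa> (e * ln (G z)) * (dG z \<bullet> v) / G z)" for z v
  have o: "open ?U" using open_Om by auto
  have der: "(\<zeta> has_derivative \<zeta>' z) (at z)" if z: "z \<in> ?U" for z
  proof -
    have "((\<lambda>z. P (e * ln (G z))) has_derivative \<zeta>' z) (at z)"
      unfolding \<zeta>'_def
      by (rule has_derivative_eq_rhs[OF DERIV_compose_FDERIV[OF P(1) has_derivative_mult_right[OF lnG_derivative[OF z]]]])
        (simp add: fun_eq_iff)
    then show ?thesis
      by (rule has_derivative_transform_within_open[OF _ o z]) (simp add: \<zeta>_def)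
  qed
  have c: "continuous_on ?U (\<lambda>z. \<zeta>' z b)" for b
  proof -
    have "continuous_on ?U (\<lambda>z. \<kappa> (e * ln (G z)))"
      by (rule continuous_on_compose2[OF cont]) (auto intro!: continuous_intros lnG_continuous)
    then show ?thesis unfolding \<zeta>'_def
      using G_pos by (intro continuous_intros G_continuous dG_continuous) force+
  qed
  have z0: "\<zeta> z = 0" if "z \<notin> shell e" for z
    using outside_shell[OF e _ that] P(2) by (simp add: \<zeta>_def)
  have eq: "indicator (shell e) z * \<zeta>' z (Y z) = e * (indicator (shell e) z * (\<kappa> (e * ln (G z)) * gr z ^ DIM('a) / G z))" for z
  proof (cases "z \<in> shell e")
    case True
    then have "z \<noteq> p" "z \<noteq> q" using shell_subset[of e] q_notin_Om by auto
    then show ?thesis by (simp add: \<zeta>'_def dG_inner_Y)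
  qed simp
  have "e * shell_integral e \<kappa> = 0"
    using flux(2)[OF der c compact_shell[of e] shell_subset[of e] z0] unfolding eq shell_integral_def integral_mult_right_zero .
  then show ?thesis using e by simp
qed

text \<open>The combination of \<kappa> and \<mu> weighted by each other's integrals has mean zero,
  so its shell integral vanishes. The constant of proportionality is never computed.\<close>

lemma shell_integral_proportional:
  assumes e: "0 < e" and k1: "continuous_on UNIV \<kappa>" "\<And>s. 1 \<le> \<bar>s\<bar> \<Longrightarrow> \<kappa> s = 0"
    and k2: "continuous_on UNIV \<mu>" "\<And>s. 1 \<le> \<bar>s\<bar> \<Longrightarrow> \<mu> s = 0"
  shows "shell_integral e \<kappa> * integral {-1..1} \<mu> = shell_integral e \<mu> * integral {-1..1} \<kappa>"
proof -
  let ?a = "integral {-1..1} \<mu>" and ?b = "integral {-1..1} \<kappa>"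
  have i: "\<kappa> integrable_on {-1..1}" "\<mu> integrable_on {-1..1}"
    using k1 k2 continuous_on_subset by (blast intro: integrable_continuous_interval)+
  have "shell_integral e (\<lambda>s. ?a * \<kappa> s - ?b * \<mu> s) = 0"
  proof (rule shell_integral_eq_0[OF e])
    show "continuous_on UNIV (\<lambda>s. ?a * \<kappa> s - ?b * \<mu> s)" using k1 k2 by (intro continuous_intros)
    show "integral {-1..1} (\<lambda>s. ?a * \<kappa> s - ?b * \<mu> s) = 0"
      using i by (simp add: integral_diff integrable_on_mult_right)
  qed (use k1 k2 in auto)
  moreover have "shell_integral e (\<lambda>s. ?a * \<kappa> s - ?b * \<mu> s) = ?a * shell_integral e \<kappa> - ?b * shell_integral e \<mu>"
  proof -
    have "indicator (shell e) z * ((?a * \<kappa> (e * ln (G z)) - ?b * \<mu> (e * ln (G z))) * gr z ^ DIM('a) / G z) =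
      ?a * (indicator (shell e) z * (\<kappa> (e * ln (G z)) * gr z ^ DIM('a) / G z)) -
      ?b * (indicator (shell e) z * (\<mu> (e * ln (G z)) * gr z ^ DIM('a) / G z))" for z
      by (simp add: algebra_simps diff_divide_distrib)
    moreover have "integrable lborel (\<lambda>z. r * (indicator (shell e) z * (f (e * ln (G z)) * gr z ^ DIM('a) / G z)))"
      if "continuous_on UNIV f" for r f
      using shell_integrable[OF that] by (rule integrable_mult_right)
    ultimately show ?thesis unfolding shell_integral_def using k1(1) k2(1)
      by (simp only: Bochner_Integration.integral_diff integral_mult_right_zero)
  qed
  ultimately show ?thesis by (simp add: mult.commute)
qed

text \<open>G^c is the formal extremal; the cutoff in the variable e ln G becomes slowly varying as
  e tends to 0. Writing G^c through \<open>exp\<close> and \<open>ln\<close> reduces smoothness to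
  that of \<open>ln (G z)\<close>.\<close>

definition trial :: "real \<Rightarrow> 'a \<Rightarrow> real" where
  "trial e z = (if z \<in> Om - {p} then exp (hardy_c DIM('a) * ln (G z)) * bump (e * ln (G z)) else 0)"

lemma trial_outside: "0 < e \<Longrightarrow> z \<notin> shell e \<Longrightarrow> trial e z = 0"
  using outside_shell[of e z] bump_outside by (auto simp: trial_def)

text \<open>\<open>G\<close> is half the difference of logarithms of squared norms, and these are
  polynomial, so no derivative of the norm itself enters.\<close>

lemma Ck_on_lnG: "Ck_on k (Om - {p}) (\<lambda>z. ln (G z))"
proof -
  have nn: "Ck_on k S (\<lambda>z. (z - c) \<bullet> (z - c))" for k S and c :: 'a
  proof (cases k)
    case (Suc j)
    have "((\<lambda>z. (z - c) \<bullet> (z - c)) has_derivative (\<lambda>v. 2 * ((z - c) \<bullet> v))) (at z)" for z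
      by (auto intro!: derivative_eq_intros simp: inner_commute)
    moreover have "Ck_on j S (\<lambda>z. 2 * ((z - c) \<bullet> b))" for b
    proof -
      have "Ck_on j S (\<lambda>z. 2 * (z \<bullet> b + - (c \<bullet> b)))"
        by (intro Ck_on_mult Ck_on_add Ck_on_const Ck_on_inner)
      then show ?thesis by (simp add: inner_diff_left)
    qed
    ultimately show ?thesis unfolding Suc by (intro Ck_on_SucI)
  qed (auto intro!: continuous_intros)
  have o: "open (Om - {p})" using open_Om by auto
  have U: "z \<noteq> p" "z \<noteq> q" "0 < G z" if "z \<in> Om - {p}" for z
    using that q_notin_Om G_pos by auto
  have "Ck_on k (Om - {p}) (\<lambda>z. (1/2) * (ln ((z - q) \<bullet> (z - q)) + - 1 * ln ((z - p) \<bullet> (z - p))))"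
    using q_notin_Om by (intro Ck_on_mult Ck_on_add Ck_on_const Ck_on_compose[OF Ck_on_ln nn]) auto
  then have "Ck_on k (Om - {p}) G"
  proof (rule Ck_on_cong[OF o, rotated])
    fix z assume "z \<in> Om - {p}"
    note u = U[OF this]
    have "ln (x \<bullet> x) = 2 * ln (norm x)" if "x \<noteq> 0" for x :: 'a
      using that by (simp add: power2_norm_eq_inner[symmetric] ln_realpow)
    then show "(1/2) * (ln ((z - q) \<bullet> (z - q)) + - 1 * ln ((z - p) \<bullet> (z - p))) = G z"
      using u by (simp add: G_def ln_div)
  qed
  then show ?thesis using U by (intro Ck_on_compose[OF Ck_on_ln]) auto
qed

lemma trial_test_function:
  assumes "0 < e"
  shows "trial e \<in> test_functions Om"
proof -
  have o: "open (Om - {p})" "open (- shell e)"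
    using open_Om compact_imp_closed[OF compact_shell] by auto
  have "Ck_on k UNIV (trial e)" for k
  proof -
    have "Ck_on k (Om - {p}) (\<lambda>z. exp (hardy_c DIM('a) * ln (G z)) * bump (e * ln (G z)))"
      by (intro Ck_on_mult Ck_on_compose[OF Ck_on_exp[of k UNIV]] Ck_on_compose[OF Ck_on_bump] Ck_on_const Ck_on_lnG) simp_all
    then have 1: "Ck_on k (Om - {p}) (trial e)"
      by (rule Ck_on_cong[OF o(1), rotated]) (simp add: trial_def)
    have 2: "Ck_on k (- shell e) (trial e)"
      by (rule Ck_on_cong[OF o(2) _ Ck_on_const[of _ _ 0]]) (simp add: trial_outside[OF assms])
    have "(Om - {p}) \<union> - shell e = UNIV" using shell_subset[of e] by auto
    then show ?thesis using Ck_on_Un[OF o 1 2] by simp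
  qed
  then have "Ck k (trial e)" for k by (rule Ck_on_imp_Ck)
  moreover have cl: "closure {z. trial e z \<noteq> 0} \<subseteq> shell e"
    using trial_outside[OF assms] compact_imp_closed[OF compact_shell]
    by (intro closure_minimal) auto
  moreover have "compact (closure {z. trial e z \<noteq> 0} \<inter> shell e)"
    by (intro closed_Int_compact closed_closure compact_shell)
  ultimately show ?thesis
    using shell_subset[of e] by (auto simp: test_functions_def Int_absorb2)
qed

lemma trial_gradient:
  assumes "z \<in> Om - {p}"
  shows "gradient (trial e) z =
    (exp (hardy_c DIM('a) * ln (G z)) * (hardy_c DIM('a) * bump (e * ln (G z)) + e * bump' (e * ln (G z))) / G z) *\<^sub>R dG z"
    (is "_ = ?k *\<^sub>R dG z")
proof -
  let ?c = "hardy_c DIM('a)"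
  have "((\<lambda>s. exp (?c * s) * bump (e * s)) has_real_derivative
      exp (?c * s) * (?c * bump (e * s) + e * bump' (e * s))) (at s)" for s
  proof -
    have "((\<lambda>s. bump (e * s)) has_real_derivative bump' (e * s) * e) (at s)"
      using DERIV_chain2[OF bump_derivative DERIV_cmult[OF DERIV_ident, of e]] by simp
    moreover have "((\<lambda>s. exp (?c * s)) has_real_derivative exp (?c * s) * ?c) (at s)"
      using DERIV_chain2[OF DERIV_exp DERIV_cmult[OF DERIV_ident, of ?c]] by simp
    ultimately show ?thesis
      by (intro DERIV_cong[OF DERIV_mult]) (auto simp: algebra_simps)
  qed
  from DERIV_compose_FDERIV[OF this lnG_derivative[OF assms]]
  have "((\<lambda>z. exp (?c * ln (G z)) * bump (e * ln (G z))) has_derivative (\<lambda>v. (?k *\<^sub>R dG z) \<bullet> v)) (at z)"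
    by (simp add: mult_ac)
  moreover have "open (Om - {p})" using open_Om by auto
  ultimately have d: "(trial e has_derivative (\<lambda>v. (?k *\<^sub>R dG z) \<bullet> v)) (at z)"
    using assms by (intro has_derivative_transform_within_open[of _ _ z UNIV "Om - {p}" "trial e"]) (auto simp: trial_def)
  have "frechet_derivative (trial e) (at z) = (\<lambda>v. (?k *\<^sub>R dG z) \<bullet> v)"
    using frechet_derivative_at[OF d] by simp
  then have "gradient (trial e) z = (\<Sum>b\<in>Basis. ((?k *\<^sub>R dG z) \<bullet> b) *\<^sub>R b)"
    by (simp add: gradient_def)
  then show ?thesis by (simp only: euclidean_representation)
qed

text \<open>Because N c = N - 1. The form t^N / t suits the later use, where t^N cancels against the
  G^N in the denominators.\<close>

lemma exp_hardy_c_power: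
  assumes "0 < t"
  shows "exp (hardy_c DIM('a) * ln t) ^ DIM('a) = t ^ DIM('a) / t"
proof -
  have "real DIM('a) * hardy_c DIM('a) = real (DIM('a) - 1)"
    using dim2 by (simp add: hardy_c_def of_nat_diff)
  then have "exp (hardy_c DIM('a) * ln t) ^ DIM('a) = exp (real (DIM('a) - 1) * ln t)"
    unfolding exp_of_nat_mult[symmetric] mult.assoc[symmetric] by simp
  also have "\<dots> = t ^ (DIM('a) - 1)" unfolding exp_of_nat_mult using assms by simp
  also have "\<dots> = t ^ DIM('a) / t" using assms dim2 by (simp add: power_diff)
  finally show ?thesis .
qed

lemma nn_integral_shell:
  assumes f: "f \<in> borel_measurable borel" and k: "continuous_on UNIV \<kappa>" "\<And>s. 0 \<le> \<kappa> s"
    and eq: "\<And>z. z \<in> shell e \<Longrightarrow> f z = \<kappa> (e * ln (G z)) * gr z ^ DIM('a) / G z"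
    and 0: "\<And>z. z \<notin> shell e \<Longrightarrow> f z = 0"
  shows "(\<integral>\<^sup>+z. ennreal (f z) \<partial>lebesgue_on Om) = ennreal (shell_integral e \<kappa>)"
proof -
  have *: "ennreal (f z) * indicator Om z = ennreal (indicator (shell e) z * (\<kappa> (e * ln (G z)) * gr z ^ DIM('a) / G z))" for z
    using eq[of z] 0[of z] shell_subset[of e] by (cases "z \<in> shell e") auto
  have nn: "0 \<le> indicator (shell e) z * (\<kappa> (e * ln (G z)) * gr z ^ DIM('a) / G z)" for z
    using k(2) by (rule shell_integrand_nonneg)
  have "(\<integral>\<^sup>+z. ennreal (f z) \<partial>lebesgue_on Om) = (\<integral>\<^sup>+z. ennreal (f z) * indicator Om z \<partial>lborel)"
    using f open_Om by (intro nn_integral_lebesgue_on_borel) auto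
  also have "\<dots> = ennreal (shell_integral e \<kappa>)"
    unfolding * shell_integral_def using nn by (intro nn_integral_eq_integral shell_integrable k AE_I2)
  finally show ?thesis .
qed

lemma trial_hardy_integral:
  assumes e: "0 < e"
  shows "(\<integral>\<^sup>+z. ennreal (\<bar>trial e z\<bar> ^ DIM('a) * W z) \<partial>lebesgue_on Om)
    = ennreal (shell_integral e (\<lambda>s. bump s ^ DIM('a)))"
proof (rule nn_integral_shell)
  have [measurable]: "trial e \<in> borel_measurable borel"
    using continuous_test_function[OF trial_test_function[OF e]] borel_measurable_continuous_onI by blast
  show "(\<lambda>z. \<bar>trial e z\<bar> ^ DIM('a) * W z) \<in> borel_measurable borel" by measurable
  show "continuous_on UNIV (\<lambda>s. bump s ^ DIM('a))" by (intro continuous_intros bump_continuous)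
  show "\<bar>trial e z\<bar> ^ DIM('a) * W z = bump (e * ln (G z)) ^ DIM('a) * gr z ^ DIM('a) / G z" if "z \<in> shell e" for z
  proof -
    have z: "z \<in> Om - {p}" "0 < G z" using shell_subset[of e] G_pos[of z] that by auto
    then have "\<bar>trial e z\<bar> = exp (hardy_c DIM('a) * ln (G z)) * bump (e * ln (G z))"
      using bump_nonneg by (simp add: trial_def)
    then show ?thesis using z(2)
      by (simp add: W_def power_mult_distrib power_divide exp_hardy_c_power)
  qed
qed (use trial_outside[OF e] dim2 bump_nonneg in auto)

lemma trial_gradient_integral:
  assumes e: "0 < e"
  shows "(\<integral>\<^sup>+z. ennreal (norm (gradient (trial e) z) ^ DIM('a)) \<partial>lebesgue_on Om)
    = ennreal (shell_integral e (\<lambda>s. \<bar>hardy_c DIM('a) * bump s + e * bump' s\<bar> ^ DIM('a)))"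
proof (rule nn_integral_shell)
  note T = trial_test_function[OF e]
  have [measurable]: "gradient (trial e) \<in> borel_measurable borel"
    using continuous_gradient[OF T] borel_measurable_continuous_onI by blast
  show "(\<lambda>z. norm (gradient (trial e) z) ^ DIM('a)) \<in> borel_measurable borel" by measurable
  show "continuous_on UNIV (\<lambda>s. \<bar>hardy_c DIM('a) * bump s + e * bump' s\<bar> ^ DIM('a))"
    by (intro continuous_intros bump_continuous)
  show "norm (gradient (trial e) z) ^ DIM('a) =
      \<bar>hardy_c DIM('a) * bump (e * ln (G z)) + e * bump' (e * ln (G z))\<bar> ^ DIM('a) * gr z ^ DIM('a) / G z"
    if "z \<in> shell e" for z
  proof -
    have z: "z \<in> Om - {p}" "z \<noteq> p" "z \<noteq> q" "0 < G z" using shell_subset[of e] G_pos[of z] q_notin_Om that by auto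
    have "norm (gradient (trial e) z) = exp (hardy_c DIM('a) * ln (G z)) *
       \<bar>hardy_c DIM('a) * bump (e * ln (G z)) + e * bump' (e * ln (G z))\<bar> / G z * gr z"
      unfolding trial_gradient[OF z(1)] using z(4) by (simp add: norm_dG[OF z(2,3)] abs_mult)
    then show ?thesis using z(4)
      by (simp add: power_mult_distrib power_divide exp_hardy_c_power)
  qed
  show "norm (gradient (trial e) z) ^ DIM('a) = 0" if "z \<notin> shell e" for z
  proof -
    have "closure {z. trial e z \<noteq> 0} \<subseteq> shell e"
      using trial_outside[OF e] compact_imp_closed[OF compact_shell] by (intro closure_minimal) auto
    then show ?thesis using gradient_outside[OF T, of z] that dim2 by auto
  qed
qed simp

text \<open>The nonnegative integrand is strictly positive on the open set |e ln G| < 1. That set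
  contains a point of the segment from \<open>p\<close> to \<open>q\<close> with G = 1, so it is not
  a null set.\<close>

lemma shell_integral_bump_pos:
  assumes e: "0 < e"
  shows "0 < shell_integral e (\<lambda>s. bump s ^ DIM('a))"
proof (rule ccontr)
  let ?U = "Om - {p}"
  let ?f = "\<lambda>z. indicator (shell e) z * (bump (e * ln (G z)) ^ DIM('a) * gr z ^ DIM('a) / G z)"
  have I: "integrable lborel ?f"
    using shell_integrable[of "\<lambda>s. bump s ^ DIM('a)" e] by (auto intro!: continuous_intros bump_continuous)
  have nn: "0 \<le> ?f z" for z
    using bump_nonneg by (intro shell_integrand_nonneg[of "\<lambda>s. bump s ^ DIM('a)"]) simp
  define V where "V = (\<lambda>z. ln (G z)) -` {- (1 / e)<..<1 / e} \<inter> ?U"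
  have oV: "open V"
  proof -
    have "open ?U" using open_Om by (rule open_delete)
    from continuous_on_open_vimage[OF this, THEN iffD1, OF lnG_continuous] show ?thesis
      unfolding V_def by simp
  qed
  have posV: "0 < ?f z" if "z \<in> V" for z
  proof -
    have z: "z \<in> ?U" "z \<noteq> p" "z \<noteq> q" "0 < G z" "\<bar>e * ln (G z)\<bar> < 1"
      using that q_notin_Om G_pos[of z] e by (auto simp: V_def abs_less_iff field_simps)
    then have "z \<in> shell e" using outside_shell[OF e z(1)] by auto
    then show ?thesis using z bump_pos gr_pos[OF z(2,3)] by simp
  qed
  \<comment> \<open>Solves (1 - t) / t = exp 1, the ratio of distances that gives G = 1.\<close>
  define t where "t = 1 / (1 + exp 1 :: real)"
  have t: "0 < t" "t < 1" "(1 - t) / t = exp 1"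
  proof -
    have "0 < 1 + exp (1 :: real)" by (intro add_pos_pos) auto
    then show "0 < t" "t < 1" "(1 - t) / t = exp 1" by (auto simp: t_def field_simps)
  qed
  define z where "z = p + t *\<^sub>R (q - p)"
  have nz: "norm (z - p) = t * norm (q - p)" "norm (z - q) = (1 - t) * norm (q - p)"
  proof -
    show "norm (z - p) = t * norm (q - p)" using t by (simp add: z_def)
    have "z - q = (1 - t) *\<^sub>R (p - q)" by (simp add: z_def algebra_simps)
    then show "norm (z - q) = (1 - t) * norm (q - p)" using t by (simp add: norm_minus_commute)
  qed
  have Gz: "G z = 1" using nz pq t by (simp add: G_def)
  have "norm (z - q) = exp 1 * norm (z - p)" unfolding nz t(3)[symmetric] using t(1) by simp
  moreover have zp: "0 < norm (z - p)" using t pq by (simp add: nz)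
  moreover have "1 * norm (z - p) < exp 1 * norm (z - p)" using zp by (intro mult_strict_right_mono) auto
  ultimately have "z \<in> V" using e Gz by (auto simp: V_def Om_def)
  assume "\<not> 0 < shell_integral e (\<lambda>s. bump s ^ DIM('a))"
  moreover have "0 \<le> (\<integral>z. ?f z \<partial>lborel)" using nn by (intro integral_nonneg_AE AE_I2)
  ultimately have "(\<integral>z. ?f z \<partial>lborel) = 0" by (simp add: shell_integral_def)
  then have "AE z in lborel. ?f z = 0"
    using integral_nonneg_eq_0_iff_AE[OF I] nn by simp
  then have "AE z in lborel. z \<notin> V"
  proof eventually_elim
    case (elim z)
    then show ?case using posV[of z] by (metis less_irrefl)
  qed
  then have "V \<in> null_sets lborel" using oV by (subst AE_iff_null_sets) auto
  then have "negligible V" by (simp add: negligible_iff_null_sets null_sets_completionI)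
  then show False using open_not_negligible[OF oV] \<open>z \<in> V\<close> by auto
qed

text \<open>On trial functions both sides are shell integrals, and proportionality turns the
  hypothesis into an inequality between integrals over [-1, 1]. Its limit e to 0 removes the
  derivative of the bump and leaves C B <= c^N B.\<close>

theorem hardy_sobolev_sharp:
  assumes C: "\<And>u g. hom_sobolev0 Om (real DIM('a)) u g \<Longrightarrow>
    ennreal C * (\<integral>\<^sup>+z. ennreal (\<bar>u z\<bar> ^ DIM('a) * W z) \<partial>lebesgue_on Om)
      \<le> (\<integral>\<^sup>+z. ennreal (norm (g z) ^ DIM('a)) \<partial>lebesgue_on Om)"
  shows "C \<le> hardy_c DIM('a) ^ DIM('a)"
proof (cases "0 \<le> C")
  \<comment> \<open>For negative \<open>C\<close> the hypothesis is void because
    \<open>ennreal C = 0\<close>, but the conclusion is immediate.\<close>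
  case False
  then show ?thesis using hardy_c(1)[OF dim2] by (smt (verit) zero_less_power)
next
  case True
  let ?n = "DIM('a)" and ?c = "hardy_c DIM('a)"
  define B where "B = integral {-1..1} (\<lambda>s. bump s ^ ?n)"
  define k where "k e s = \<bar>?c * bump s + e * bump' s\<bar> ^ ?n" for e s
  have kc: "continuous_on UNIV (k e)" for e
    unfolding k_def[abs_def] by (intro continuous_intros bump_continuous)
  have bc: "continuous_on UNIV (\<lambda>s. bump s ^ ?n)" by (intro continuous_intros bump_continuous)
  have k0: "k e s = 0" "bump s ^ ?n = 0" if "1 \<le> \<bar>s\<bar>" for e s
    using bump_outside[OF that] dim2 by (auto simp: k_def)
  have "0 \<le> B" unfolding B_def using bump_nonneg by (intro integral_nonneg integrable_continuous_interval continuous_on_subset[OF bc]) auto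
  \<comment> \<open>If \<open>B\<close> were 0, the mean-zero criterion with e = 1 would make a
    positive shell integral vanish.\<close>
  moreover have "B \<noteq> 0"
    using shell_integral_eq_0[OF zero_less_one bc k0(2)] shell_integral_bump_pos[OF zero_less_one] by (auto simp: B_def)
  ultimately have B: "0 < B" by simp
  have le: "C * B \<le> integral {-1..1} (k e)" if e: "0 < e" for e
  proof -
    let ?J = "shell_integral e (\<lambda>s. bump s ^ ?n)"
    have J: "0 < ?J" by (rule shell_integral_bump_pos[OF e])
    have "ennreal C * ennreal ?J \<le> ennreal (shell_integral e (k e))"
      using C[OF test_function_hom_sobolev0[OF trial_test_function[OF e]]]
      unfolding trial_hardy_integral[OF e] trial_gradient_integral[OF e] k_def[abs_def] .
    then have "ennreal (C * ?J) \<le> ennreal (shell_integral e (k e))"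
      using True J by (simp add: ennreal_mult)
    moreover have "0 \<le> shell_integral e (k e)"
      unfolding shell_integral_def
      by (intro integral_nonneg_AE AE_I2 shell_integrand_nonneg) (simp add: k_def)
    ultimately have "C * ?J \<le> shell_integral e (k e)" by (simp add: ennreal_le_iff)
    then have "C * ?J * B \<le> shell_integral e (k e) * B" using B by (intro mult_right_mono) auto
    also have "\<dots> = ?J * integral {-1..1} (k e)"
      unfolding B_def by (rule shell_integral_proportional[OF e kc k0(1) bc k0(2)])
    finally have "?J * (C * B) \<le> ?J * integral {-1..1} (k e)" by (simp add: mult_ac)
    then show ?thesis using J by simp
  qed
  have "continuous_on UNIV (\<lambda>e. integral (cbox (-1) 1) (k e))"
  proof (rule integral_continuous_on_param)
    have "continuous_on S (\<lambda>x. bump (snd x))" "continuous_on S (\<lambda>x. bump' (snd x))" for S :: "(real \<times> real) set"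
      by (rule continuous_on_compose2[OF bump_continuous(1)[of UNIV] continuous_on_snd[OF continuous_on_id]]
          continuous_on_compose2[OF bump_continuous(2)[of UNIV] continuous_on_snd[OF continuous_on_id]], simp)+
    then show "continuous_on (UNIV \<times> cbox (-1) 1) (\<lambda>(e, s). k e s)"
      unfolding k_def case_prod_beta by (intro continuous_intros)
  qed
  then have "isCont (\<lambda>e. integral {-1..1} (k e)) 0"
    by (simp add: continuous_on_eq_continuous_at)
  then have "(\<lambda>j. integral {-1..1} (k (inverse (real (Suc j))))) \<longlonglongrightarrow> integral {-1..1} (k 0)"
    using LIMSEQ_inverse_real_of_nat by (rule isCont_tendsto_compose)
  moreover have "C * B \<le> integral {-1..1} (k (inverse (real (Suc j))))" for j
    by (rule le) simp
  ultimately have "C * B \<le> integral {-1..1} (k 0)" by (intro LIMSEQ_le_const) auto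
  also have "\<dots> = ?c ^ ?n * B"
  proof -
    have "k 0 s = ?c ^ ?n * bump s ^ ?n" for s
      using hardy_c(1)[OF dim2] bump_nonneg by (simp add: k_def abs_mult power_mult_distrib)
    then have "k 0 = (\<lambda>s. ?c ^ ?n * bump s ^ ?n)" by (rule ext)
    then show ?thesis by (simp add: B_def)
  qed
  finally show ?thesis using B by simp
qed

end

section \<open>The half-space\<close>

text \<open>With 0 < n both sides are 0 at a = 0, so the weights can be compared at the pole as
  well.\<close>

lemma powr_half_nat: "0 \<le> a \<Longrightarrow> 0 < n \<Longrightarrow> a powr (real n / 2) = sqrt a ^ n"
  by (cases "a = 0") (simp_all add: powr_realpow powr_powr flip: powr_half_sqrt powr_realpow)

theorem theorem1p1:
  fixes N :: nat
  assumes "N \<ge> 2" and "CARD('m::finite) = N - 1"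
  shows
    "(\<forall>(u :: (real ^ 'm) \<times> real \<Rightarrow> real) g. hom_sobolev0 half_space (real N) u g \<longrightarrow>
        ennreal (((real N - 1) / real N) ^ N) * hardy_integral N u \<le> gradient_integral N g) \<and>
     (\<forall>C :: real.
        (\<forall>(u :: (real ^ 'm) \<times> real \<Rightarrow> real) g. hom_sobolev0 half_space (real N) u g \<longrightarrow>
           ennreal C * hardy_integral N u \<le> gradient_integral N g) \<longrightarrow>
        C \<le> ((real N - 1) / real N) ^ N) \<and>
     (\<forall>(u :: (real ^ 'm) \<times> real \<Rightarrow> real) g. hom_sobolev0 half_space (real N) u g \<and>
        \<not> (AE z in lebesgue_on half_space. u z = 0) \<longrightarrow>
        ennreal (((real N - 1) / real N) ^ N) * hardy_integral N u \<noteq> gradient_integral N g)"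
proof -
  let ?p = "(0, 1) :: (real ^ 'm) \<times> real" and ?q = "(0, - 1) :: (real ^ 'm) \<times> real"
  have N: "DIM((real ^ 'm) \<times> real) = N" using assms by simp
  \<comment> \<open>For these mirror-image poles \<open>Om\<close> is the half-space, and the
    remaining work is to identify the integrands.\<close>
  interpret two_poles ?p ?q
    by unfold_locales (use N assms in auto)
  have np: "norm ((x, y) - ?p) = sqrt ((norm x)\<^sup>2 + (1 - y)\<^sup>2)"
    and nq: "norm ((x, y) - ?q) = sqrt ((norm x)\<^sup>2 + (1 + y)\<^sup>2)" for x :: "real ^ 'm" and y
    by (simp_all add: norm_Pair power2_commute[of y] add.commute[of y])
  have "(x, y) \<in> Om \<longleftrightarrow> (x, y) \<in> half_space" for x :: "real ^ 'm" and y
  proof -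
    have "(1 - y)\<^sup>2 < (1 + y)\<^sup>2 \<longleftrightarrow> 0 < y" by (simp add: power2_eq_square algebra_simps)
    moreover have "(x, y) \<in> Om \<longleftrightarrow>
        sqrt ((norm x)\<^sup>2 + (1 - y)\<^sup>2) < sqrt ((norm x)\<^sup>2 + (1 + y)\<^sup>2)"
      unfolding Om_def mem_Collect_eq np nq ..
    ultimately show ?thesis by (simp add: half_space_def)
  qed
  then have Om: "Om = half_space" by auto
  have hardy: "hardy_integral N u = (\<integral>\<^sup>+z. ennreal (\<bar>u z\<bar> ^ DIM((real ^ 'm) \<times> real) * W z) \<partial>lebesgue_on Om)"
    for u :: "(real ^ 'm) \<times> real \<Rightarrow> real"
    unfolding hardy_integral_def Om
  proof (intro nn_integral_cong, clarify)
    fix x :: "real ^ 'm" and y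
    define a b where "a = (norm x)\<^sup>2 + (1 - y)\<^sup>2" and "b = (norm x)\<^sup>2 + (1 + y)\<^sup>2"
    have ab: "0 \<le> a" "0 \<le> b" by (simp_all add: a_def b_def)
    \<comment> \<open>This distance accounts for the 4 in the weight: 2 / (sqrt a sqrt b) is the
      reciprocal of sqrt a sqrt (b / 4). The integrands agree at every point, the pole
      included.\<close>
    have "norm (?p - ?q) = 2" by (simp add: norm_Pair)
    then have W: "W (x, y) = (2 / (sqrt a * sqrt b) / ln (sqrt b / sqrt a)) ^ N"
      unfolding W_def gr_def G_def N np nq a_def b_def by simp
    have "a powr (real N / 2) = sqrt a ^ N" "(b / 4) powr (real N / 2) = (sqrt b / 2) ^ N"
      using ab assms by (simp_all add: powr_half_nat real_sqrt_divide)
    then show "ennreal (\<bar>u (x, y)\<bar> ^ N /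
      (((norm x)\<^sup>2 + (1 - y)\<^sup>2) powr (real N / 2) *
       (((norm x)\<^sup>2 + (1 + y)\<^sup>2) / 4) powr (real N / 2) *
       (ln (sqrt (((norm x)\<^sup>2 + (1 + y)\<^sup>2) / ((norm x)\<^sup>2 + (1 - y)\<^sup>2)))) ^ N))
      = ennreal (\<bar>u (x, y)\<bar> ^ DIM((real ^ 'm) \<times> real) * W (x, y))"
      unfolding W N a_def[symmetric] b_def[symmetric]
      by (simp add: real_sqrt_divide power_divide power_mult_distrib)
  qed
  have grad: "gradient_integral N g = (\<integral>\<^sup>+z. ennreal (norm (g z) ^ DIM((real ^ 'm) \<times> real)) \<partial>lebesgue_on Om)"
    for g :: "(real ^ 'm) \<times> real \<Rightarrow> (real ^ 'm) \<times> real"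
    unfolding gradient_integral_def Om N ..
  have c: "((real N - 1) / real N) ^ N = hardy_c DIM((real ^ 'm) \<times> real) ^ DIM((real ^ 'm) \<times> real)"
    unfolding hardy_c_def N ..
  have H: "hom_sobolev0 half_space (real N) = hom_sobolev0 Om (real DIM((real ^ 'm) \<times> real))"
    unfolding Om N ..
  show ?thesis unfolding c hardy grad H
  proof (intro conjI allI impI, goal_cases)
    case (1 u g)
    then show ?case by (rule hardy_sobolev)
  next
    case (2 C)
    then show ?case by (intro hardy_sobolev_sharp) simp
  next
    case (3 u g)
    then have "\<not> (AE z in lebesgue_on Om. u z = 0)" unfolding Om by (rule conjunct2)
    then show ?case using 3 hardy_sobolev_not_attained[of u g] by blast
  qed
qed

end
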